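(* Let $n\geq 2$ and let $Z$ be a zonoid in $\mathbb{R}^n$. Then $$\min_{\xi\in S^{n-1}}|P_{\xi^{\perp}}(Z)|\leq \frac{nb_n}{n-1}\,|Z|^{\frac{n-1}{n}}.$$
   Context: A convex body in $\mathbb{R}^n$ is a compact convex set with non-empty interior. $|\cdot|$ denotes volume in the appropriate dimension, $\omega_m$ is the volume of the Euclidean unit ball in $\mathbb{R}^m$, $S^{n-1}$ is the Euclidean unit sphere, $P_{\xi^{\perp}}$ is the orthogonal projection onto the hyperplane $\xi^{\perp}$, and $$b_n=\frac{(n-1)\omega_{n-1}}{n\omega_n^{\frac{n-1}{n}}}.$$ A zonoid is an origin-symmetric convex body that is a limit, in the Hausdorff metric, of Minkowski sums of line segments; equivalently, its support function is $h_Z(x)=\frac12\int_{S^{n-1}}|\langle x,y\rangle|\,d\mu(y)$ for some positive measure $\mu$ on $S^{n-1}$; equivalently, $Z$ is a projection body, i.e. there is a convex body $K$ with $h_Z(\xi)=|P_{\xi^\perp}(K)|$ for all $\xi\in S^{n-1}$. *)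

theory Defs
  imports "HOL-Analysis.Analysis"
begin

definition convex_body :: "'a::euclidean_space set \<Rightarrow> bool" where
  "convex_body K \<longleftrightarrow> compact K \<and> convex K \<and> interior K \<noteq> {}"

(* Meaningful for non-empty bounded sets: the suprema are then finite, and all sets below are
   non-empty and bounded. *)
definition hausdorff_dist :: "'a::metric_space set \<Rightarrow> 'a set \<Rightarrow> real" where
  "hausdorff_dist A B = max (SUP a\<in>A. infdist a B) (SUP b\<in>B. infdist b A)"

(* The sum is the Minkowski sum of sets (HOL-Library.Set_Algebras); segments may be degenerate and
   need not be centred at the origin. *)
definition segment_sum :: "'a::euclidean_space set \<Rightarrow> bool" where
  "segment_sum A \<longleftrightarrow> (\<exists>(m::nat) u v. A = (\<Sum>i<m. closed_segment (u i) (v i)))"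

definition zonoid :: "'a::euclidean_space set \<Rightarrow> bool" where
  "zonoid Z \<longleftrightarrow> convex_body Z \<and> uminus ` Z = Z \<and>
     (\<exists>A. (\<forall>k. segment_sum (A k)) \<and> (\<lambda>k. hausdorff_dist (A k) Z) \<longlonglongrightarrow> 0)"

definition orthonormal_basis_of :: "'a::euclidean_space set \<Rightarrow> 'a set \<Rightarrow> bool" where
  "orthonormal_basis_of V B \<longleftrightarrow>
     pairwise orthogonal B \<and> (\<forall>b\<in>B. norm b = 1) \<and> independent B \<and> span B = V"

(* Lebesgue measure of dimension dim V on the subspace V, as a Borel measure on the ambient space.
   This is the definition of lborel with Basis replaced by an orthonormal basis of V; by
   rotation invariance of Lebesgue measure the choice of that basis does not matter, and by
   orthonormal_basis_subspace one exists. *)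
definition subspace_lborel :: "'a::euclidean_space set \<Rightarrow> 'a measure" where
  "subspace_lborel V =
     (let B = (SOME B. orthonormal_basis_of V B)
      in distr (\<Pi>\<^sub>M b\<in>B. lborel) borel (\<lambda>f. \<Sum>b\<in>B. f b *\<^sub>R b))"

(* Orthogonal projection onto {\<xi>}\<^sup>\<bottom>; the division makes this correct for every \<xi>, not only for
   unit vectors. *)
definition perp_proj :: "'a::euclidean_space \<Rightarrow> 'a \<Rightarrow> 'a" where
  "perp_proj \<xi> x = x - ((x \<bullet> \<xi>) / (\<xi> \<bullet> \<xi>)) *\<^sub>R \<xi>"

definition perp_proj_vol :: "'a::euclidean_space \<Rightarrow> 'a set \<Rightarrow> real" where
  "perp_proj_vol \<xi> K = measure (subspace_lborel ({\<xi>}\<^sup>\<bottom>)) (perp_proj \<xi> ` K)"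

definition b_const :: "nat \<Rightarrow> real" where
  "b_const n = (real n - 1) * unit_ball_vol (real n - 1) /
     (real n * unit_ball_vol (real n) powr ((real n - 1) / real n))"

end

theory Submission
  imports Defs "HOL-Probability.Distribution_Functions"
begin

text \<open>
  Let \<open>m\<close> be the minimal projection volume of \<open>Z\<close>, let \<open>B\<close> be the unit ball, and let \<open>A = \<Sum>\<^sub>i [0, y\<^sub>i]\<close>
  approximate \<open>Z\<close> up to translation; put \<open>L = \<Sum>\<^sub>i |y\<^sub>i|\<close>. Adding a segment \<open>[0, y]\<close> to a convex body
  increases its volume by \<open>|y|\<close> times the volume of its projection along \<open>y\<close>. Adding the \<open>[0, e y\<^sub>i]\<close>
  to \<open>Z\<close> one after the other therefore gives \<open>|Z + e A| \<ge> |Z| + e m L\<close>, and since \<open>Z + e A\<close> is almost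
  \<open>(1 + e) Z\<close>, differentiation at \<open>e = 0\<close> yields \<open>m L \<le> n |Z|\<close>. Adding them to \<open>B\<close> gives
  \<open>|B + e A| \<le> |B| + e L \<omega>\<^sub>n\<^sub>-\<^sub>1 + o(e)\<close>, which together with the Brunn--Minkowski inequality for \<open>B\<close> and
  \<open>e Z\<close> yields Urysohn's inequality \<open>n |B|\<^bsup>(n-1)/n\<^esup> |Z|\<^bsup>1/n\<^esup> \<le> \<omega>\<^sub>n\<^sub>-\<^sub>1 L\<close>. Multiply the two estimates.
\<close>

subsection \<open>Volume and projections onto hyperplanes\<close>

text \<open>The total length \<open>L\<close> links the two estimates: it is a fixed multiple of the
  mean width of \<open>A\<close>, and \<open>m L \<le> n |Z|\<close> is what remains of a mixed
  volume of \<open>Z\<close> when one of its copies is expanded into segments. Differentiating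
  actual volumes at \<open>e = 0\<close> replaces mixed volumes and the generating measure of a
  zonoid: only finite sums occur, and the growth of volume under one segment. The price is that
  \<open>A\<close> is only Hausdorff-close to \<open>Z\<close>, at some distance \<open>d\<close>.
  In the first estimate a ball of radius \<open>r\<close> inside \<open>Z\<close> converts this
  error into a growth rate \<open>1 + d / r\<close> in place of 1; in the second it is absorbed by
  enlarging the unit ball to radius \<open>1 + e d\<close>. After multiplication \<open>L\<close>
  cancels, no trace of \<open>A\<close> is left, and \<open>d\<close> can tend to 0. Both estimates
  are equalities in the limit when \<open>Z\<close> is a ball. Hence the constant is the one
  attained by balls: \<open>n b_n / (n - 1) = \<omega>_{n-1} / \<omega>_n^{(n-1)/n}\<close>.\<close>

text \<open>
  Isometries map balls to balls, and by Vitali's theorem disjoint balls fill an open set. (The library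
  has rotation invariance only for \<open>real ^ 'n\<close> with a well-ordered index type.)
\<close>

lemma emeasure_lborel_orthogonal_image_ge:
  fixes f :: "'a::euclidean_space \<Rightarrow> 'a"
  assumes f: "orthogonal_transformation f" and U: "open U"
  shows "emeasure lborel U \<le> emeasure lborel (f ` U)"
proof -
  define K where "K = {(x::'a, r::real). 0 < r \<and> ball x r \<subseteq> U}"
  have cov: "\<exists>i. i \<in> K \<and> x \<in> ball (fst i) (snd i) \<and> snd i < d" if xd: "x \<in> U" "0 < d" for x d
  proof -
    obtain e where e: "e > 0" "ball x e \<subseteq> U" using U xd(1) by (meson openE)
    define r where "r = min e (d/2)"
    have "0 < r" "r < d" "ball x r \<subseteq> U"
      using e xd(2) subset_ball[of r e x] by (auto simp: r_def)
    then have "(x, r) \<in> K" "x \<in> ball x r" by (auto simp: K_def)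
    with \<open>r < d\<close> show ?thesis by (intro exI[of _ "(x, r)"]) simp
  qed
  obtain C where C: "countable C" "C \<subseteq> K"
    "pairwise (\<lambda>i j. disjnt (ball (fst i) (snd i)) (ball (fst j) (snd j))) C"
    "negligible (U - (\<Union>i\<in>C. ball (fst i) (snd i)))"
    using Vitali_covering_theorem_balls[of U K fst snd, OF cov] by blast
  define B where "B = (\<lambda>i::'a \<times> real. ball (fst i) (snd i))"
  have BU: "(\<Union>i\<in>C. B i) \<subseteq> U" using C(2) by (fastforce simp: B_def K_def)
  have disj: "disjoint_family_on B C"
    using C(3) by (auto simp: disjoint_family_on_def pairwise_def disjnt_def B_def)
  have inj: "inj f" using f by (rule orthogonal_transformation_inj)
  have disj': "disjoint_family_on (\<lambda>i. f ` B i) C"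
    using disj inj unfolding disjoint_family_on_def by (metis image_Int image_empty)
  have fB: "f ` B i = ball (f (fst i)) (snd i)" for i
    unfolding B_def by (rule image_orthogonal_transformation_ball[OF f])
  have fU: "open (f ` U)"
  proof -
    have "linear f" "surj f" using f by (auto simp: orthogonal_transformation_linear orthogonal_transformation_surj)
    then show ?thesis using U open_surjective_linear_image by blast
  qed
  have null: "U - (\<Union>i\<in>C. B i) \<in> null_sets lborel"
  proof -
    have "U - (\<Union>i\<in>C. B i) \<in> sets lborel"
      using U C(1) unfolding B_def by (intro sets.Diff sets.countable_UN'') (auto intro: borel_open)
    then show ?thesis
      using C(4) by (simp add: B_def negligible_iff_null_sets null_sets_completion_iff)
  qed
  have "emeasure lborel U = emeasure lborel ((\<Union>i\<in>C. B i) \<union> (U - (\<Union>i\<in>C. B i)))"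
    using BU by (simp add: Un_absorb1)
  also have "\<dots> = emeasure lborel (\<Union>i\<in>C. B i)"
    using null C(1) by (intro emeasure_Un_null_set) (auto simp: B_def)
  also have "\<dots> = (\<integral>\<^sup>+i. emeasure lborel (B i) \<partial>count_space C)"
    using C(1) disj by (intro emeasure_UN_countable) (auto simp: B_def)
  also have "\<dots> = (\<integral>\<^sup>+i. emeasure lborel (f ` B i) \<partial>count_space C)"
  proof (intro nn_integral_cong)
    fix i assume "i \<in> space (count_space C)"
    then have "0 < snd i" using C(2) by (auto simp: K_def)
    then show "emeasure lborel (B i) = emeasure lborel (f ` B i)"
      unfolding fB unfolding B_def by (simp add: emeasure_ball)
  qed
  also have "\<dots> = emeasure lborel (\<Union>i\<in>C. f ` B i)"
    using C(1) disj' by (intro emeasure_UN_countable[symmetric]) (auto simp: fB)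
  also have "\<dots> \<le> emeasure lborel (f ` U)"
    using BU fU by (intro emeasure_mono) auto
  finally show ?thesis .
qed

text \<open>Lebesgue measure is determined by its values on boxes. Preimages of boxes are open, so
  the one-sided estimate for open sets applies to \<open>f\<close> and to its inverse, and the two
  together give equality.\<close>

lemma distr_lborel_orthogonal_transformation:
  fixes f :: "'a::euclidean_space \<Rightarrow> 'a"
  assumes f: "orthogonal_transformation f"
  shows "distr lborel borel f = lborel"
proof (rule lborel_eqI[symmetric])
  have [measurable]: "f \<in> borel_measurable borel"
    using f by (intro borel_measurable_continuous_onI linear_continuous_on)
      (simp add: linear_linear orthogonal_transformation_linear)
  have finv: "orthogonal_transformation (inv f)" and surj: "surj f" and inj: "inj f"
    using f by (auto simp: orthogonal_transformation_inv orthogonal_transformation_surj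
        orthogonal_transformation_inj)
  fix l u :: 'a assume lu: "\<And>b. b \<in> Basis \<Longrightarrow> l \<bullet> b \<le> u \<bullet> b"
  have vim: "f -` box l u = inv f ` box l u"
    using surj inj by (auto simp: bij_def intro!: bij_vimage_eq_inv_image)
  have op: "open (f -` box l u)"
    using f by (intro open_vimage linear_continuous_on)
      (auto simp: linear_linear orthogonal_transformation_linear)
  have "emeasure lborel (f -` box l u) = emeasure lborel (box l u)"
  proof (rule antisym)
    show "emeasure lborel (f -` box l u) \<le> emeasure lborel (box l u)"
      using emeasure_lborel_orthogonal_image_ge[OF f op] surj by (simp add: surj_image_vimage_eq)
    show "emeasure lborel (box l u) \<le> emeasure lborel (f -` box l u)"
      using emeasure_lborel_orthogonal_image_ge[OF finv open_box] by (simp add: vim)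
  qed
  then show "emeasure (distr lborel borel f) (box l u) = (\<Prod>b\<in>Basis. (u - l) \<bullet> b)"
    using lu by (simp add: emeasure_distr emeasure_lborel_box_eq)
qed simp

lemma orthonormal_basis_of_inner:
  assumes "orthonormal_basis_of V C" "b \<in> C" "c \<in> C"
  shows "b \<bullet> c = (if b = c then 1 else 0)"
  using assms by (auto simp: orthonormal_basis_of_def pairwise_def orthogonal_def norm_eq_sqrt_inner)

lemma orthonormal_basis_of_finite:
  "orthonormal_basis_of V C \<Longrightarrow> finite (C :: 'a::euclidean_space set)"
  by (simp add: orthonormal_basis_of_def independent_imp_finite)

text \<open>Rotation invariance in the form used for slicing: volume may be computed in coordinates
  adapted to a given direction. The coordinate map of \<open>C\<close> factors into a relabelling of
  the standard coordinates, which is harmless, followed by an isometry.\<close>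

lemma lborel_eq_orthonormal_basis:
  fixes C :: "'a::euclidean_space set"
  assumes C: "orthonormal_basis_of UNIV C"
  shows "lborel = distr (\<Pi>\<^sub>M c\<in>C. lborel) borel (\<lambda>f. \<Sum>c\<in>C. f c *\<^sub>R c)"
proof -
  interpret product_sigma_finite "\<lambda>_::'a. lborel :: real measure" by standard
  have fin: "finite C" using C by (rule orthonormal_basis_of_finite)
  have "card C = DIM('a)"
    using C by (metis orthonormal_basis_of_def dim_UNIV dim_span dim_eq_card_independent)
  then obtain \<phi> where \<phi>: "bij_betw \<phi> (Basis :: 'a set) C"
    using finite_same_card_bij[of "Basis :: 'a set" C] fin by auto
  define \<psi> where "\<psi> = inv_into Basis \<phi>"
  have \<phi>C: "\<phi> b \<in> C" if "b \<in> Basis" for b using \<phi> that by (auto simp: bij_betw_def)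
  have \<phi>\<psi>: "\<phi> (\<psi> c) = c" "\<psi> c \<in> Basis" if "c \<in> C" for c
    using \<phi> that by (auto simp: bij_betw_def \<psi>_def f_inv_into_f intro: inv_into_into)
  have \<psi>\<phi>: "\<psi> (\<phi> b) = b" if "b \<in> Basis" for b
    using \<phi> that by (auto simp: bij_betw_def \<psi>_def)
  let ?P = "\<Pi>\<^sub>M c\<in>C. (lborel :: real measure)"
  \<comment> \<open>Reads coordinates indexed by \<open>C\<close> as standard coordinates through
    the bijection \<open>\<phi>\<close>; preimages of boxes are product sets, so the pushforward is
    \<open>lborel\<close> by direct computation.\<close>
  define g where "g = (\<lambda>f :: 'a \<Rightarrow> real. \<Sum>b\<in>Basis. f (\<phi> b) *\<^sub>R b)"
  have [measurable]: "g \<in> measurable ?P borel"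
    unfolding g_def using \<phi>C by measurable
  have 1: "lborel = distr ?P borel g"
  proof (rule lborel_eqI)
    fix l u :: 'a assume lu: "\<And>b. b \<in> Basis \<Longrightarrow> l \<bullet> b \<le> u \<bullet> b"
    have gb: "g f \<bullet> b = f (\<phi> b)" if "b \<in> Basis" for f b
      using that by (simp add: g_def inner_sum_left inner_Basis if_distrib cong: if_cong)
    have "g -` box l u \<inter> space ?P = (\<Pi>\<^sub>E c\<in>C. {l \<bullet> \<psi> c <..< u \<bullet> \<psi> c})"
    proof -
      have "(\<forall>b\<in>Basis. l \<bullet> b < f (\<phi> b) \<and> f (\<phi> b) < u \<bullet> b) \<longleftrightarrow>
          (\<forall>c\<in>C. l \<bullet> \<psi> c < f c \<and> f c < u \<bullet> \<psi> c)" for f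
        using \<phi>C \<phi>\<psi> \<psi>\<phi> by force
      then show ?thesis
        unfolding space_PiM by (auto simp: box_def gb PiE_iff)
    qed
    then have "emeasure (distr ?P borel g) (box l u) = (\<Prod>c\<in>C. emeasure lborel {l \<bullet> \<psi> c <..< u \<bullet> \<psi> c})"
      using fin by (simp add: emeasure_distr emeasure_PiM)
    also have "\<dots> = (\<Prod>b\<in>Basis. emeasure lborel {l \<bullet> b <..< u \<bullet> b})"
      using \<phi> by (subst prod.reindex_bij_betw[OF \<phi>, symmetric]) (simp add: \<psi>\<phi>)
    also have "\<dots> = (\<Prod>b\<in>Basis. ennreal ((u - l) \<bullet> b))"
      using lu by (intro prod.cong) (auto simp: inner_diff_left)
    also have "\<dots> = ennreal (\<Prod>b\<in>Basis. (u - l) \<bullet> b)"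
      using lu by (intro prod_ennreal) (auto simp: inner_diff_left)
    finally show "emeasure (distr ?P borel g) (box l u) = (\<Prod>b\<in>Basis. (u - l) \<bullet> b)" .
  qed simp
  \<comment> \<open>The isometry carrying the standard basis to \<open>C\<close>; composed with
    \<open>g\<close> it gives the coordinate map of \<open>C\<close>.\<close>
  define T where "T = (\<lambda>x::'a. \<Sum>b\<in>Basis. (x \<bullet> b) *\<^sub>R \<phi> b)"
  have orth: "\<phi> b \<bullet> \<phi> c = (if b = c then 1 else 0)" if "b \<in> Basis" "c \<in> Basis" for b c
    using orthonormal_basis_of_inner[OF C \<phi>C[OF that(1)] \<phi>C[OF that(2)]] that \<psi>\<phi> by metis
  have "T x \<bullet> T y = x \<bullet> y" for x y
  proof -
    have "T x \<bullet> T y = (\<Sum>b\<in>Basis. \<Sum>c\<in>Basis. (x \<bullet> b) * ((y \<bullet> c) * (\<phi> b \<bullet> \<phi> c)))"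
      by (simp add: T_def inner_sum_left inner_sum_right[of _ _ Basis] sum_distrib_left, subst sum.swap, simp add: ac_simps)
    also have "\<dots> = (\<Sum>b\<in>Basis. \<Sum>c\<in>Basis. if b = c then (x \<bullet> b) * (y \<bullet> c) else 0)"
      by (intro sum.cong) (auto simp: orth)
    also have "\<dots> = x \<bullet> y" by (simp add: euclidean_inner[of x y])
    finally show ?thesis .
  qed
  moreover have "linear T"
    unfolding T_def by (intro linearI) (simp_all add: inner_add_left scaleR_add_left sum.distrib scaleR_sum_right)
  ultimately have T: "orthogonal_transformation T"
    by (simp add: orthogonal_transformation_def)
  have [measurable]: "T \<in> borel_measurable borel"
    unfolding T_def by measurable
  have "T (g f) = (\<Sum>c\<in>C. f c *\<^sub>R c)" for f
  proof -
    have "T (g f) = (\<Sum>b\<in>Basis. f (\<phi> b) *\<^sub>R \<phi> b)"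
      unfolding T_def g_def
      by (intro sum.cong) (auto simp: inner_sum_left inner_Basis if_distrib cong: if_cong)
    also have "\<dots> = (\<Sum>c\<in>C. f c *\<^sub>R c)" by (rule sum.reindex_bij_betw[OF \<phi>])
    finally show ?thesis .
  qed
  then have "distr ?P borel (\<lambda>f. \<Sum>c\<in>C. f c *\<^sub>R c) = distr (distr ?P borel g) borel T"
    by (subst distr_distr) (auto simp: comp_def)
  also have "\<dots> = lborel"
    unfolding 1[symmetric] by (rule distr_lborel_orthogonal_transformation[OF T])
  finally show ?thesis by simp
qed


section \<open>Coordinates on a hyperplane and slicing along its normal\<close>

text \<open>Literally the choice made inside \<open>subspace_lborel\<close>, so that the measure on
  the hyperplane unfolds to a pushforward along \<open>perp_point\<close> and no independence of the
  basis has to be shown.\<close>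

definition perp_basis :: "'a::euclidean_space \<Rightarrow> 'a set" where
  "perp_basis \<xi> = (SOME B. orthonormal_basis_of ({\<xi>}\<^sup>\<bottom>) B)"

definition perp_point :: "'a::euclidean_space \<Rightarrow> ('a \<Rightarrow> real) \<Rightarrow> 'a" where
  "perp_point \<xi> f = (\<Sum>b\<in>perp_basis \<xi>. f b *\<^sub>R b)"

lemma subspace_lborel_perp:
  "subspace_lborel ({\<xi>}\<^sup>\<bottom>) = distr (\<Pi>\<^sub>M b\<in>perp_basis \<xi>. lborel) borel (perp_point \<xi>)"
  by (simp add: subspace_lborel_def perp_basis_def perp_point_def[abs_def] Let_def)

lemma measurable_perp_point [measurable]:
  "perp_point \<xi> \<in> measurable (\<Pi>\<^sub>M b\<in>perp_basis \<xi>. lborel) borel"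
  unfolding perp_point_def[abs_def] by measurable

lemma mem_orthogonal_comp_singleton: "x \<in> {\<xi>}\<^sup>\<bottom> \<longleftrightarrow> \<xi> \<bullet> x = 0"
  by (simp add: orthogonal_comp_def orthogonal_def)

lemma perp_basis: "orthonormal_basis_of ({\<xi>}\<^sup>\<bottom>) (perp_basis \<xi>)"
proof -
  obtain B where "pairwise orthogonal B" "\<And>x. x \<in> B \<Longrightarrow> norm x = 1" "independent B"
    "span B = {\<xi>}\<^sup>\<bottom>"
    using orthonormal_basis_subspace[OF subspace_orthogonal_comp[of "{\<xi>}"]] by metis
  then have "orthonormal_basis_of ({\<xi>}\<^sup>\<bottom>) B"
    by (simp add: orthonormal_basis_of_def)
  then show ?thesis
    unfolding perp_basis_def by (rule someI)
qed

lemmas finite_perp_basis [simp] = orthonormal_basis_of_finite[OF perp_basis]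

lemma inner_perp_basis:
  assumes "b \<in> perp_basis \<xi>"
  shows "\<xi> \<bullet> b = 0" "b \<bullet> \<xi> = 0"
  using assms perp_basis[of \<xi>] span_base[of b "perp_basis \<xi>"]
  by (auto simp: orthonormal_basis_of_def mem_orthogonal_comp_singleton inner_commute)

lemma inner_perp_point [simp]: "perp_point \<xi> f \<bullet> \<xi> = 0"
  by (simp add: perp_point_def inner_sum_left inner_perp_basis)

lemma
  assumes "norm \<xi> = 1"
  shows not_mem_perp_basis: "\<xi> \<notin> perp_basis \<xi>"
    and orthonormal_basis_insert_perp: "orthonormal_basis_of UNIV (insert \<xi> (perp_basis \<xi>))"
proof -
  have xx: "\<xi> \<bullet> \<xi> = 1" using assms by (simp add: norm_eq_1)
  show n: "\<xi> \<notin> perp_basis \<xi>"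
    using inner_perp_basis[of \<xi> \<xi>] xx by auto
  note B = perp_basis[of \<xi>, unfolded orthonormal_basis_of_def]
  have pw: "pairwise orthogonal (insert \<xi> (perp_basis \<xi>))"
    using B by (auto simp: pairwise_insert orthogonal_def inner_perp_basis)
  have nm: "norm b = 1" if "b \<in> insert \<xi> (perp_basis \<xi>)" for b
    using that B assms by auto
  have ind: "independent (insert \<xi> (perp_basis \<xi>))"
    using pw nm by (intro pairwise_orthogonal_independent) (use nm in force)+
  have "x \<in> span (insert \<xi> (perp_basis \<xi>))" for x
  proof -
    have "x - (x \<bullet> \<xi>) *\<^sub>R \<xi> \<in> span (perp_basis \<xi>)"
      using B xx by (auto simp: mem_orthogonal_comp_singleton inner_diff_right inner_commute)
    then show ?thesis using span_breakdown_eq by blast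
  qed
  then show "orthonormal_basis_of UNIV (insert \<xi> (perp_basis \<xi>))"
    using pw nm ind by (auto simp: orthonormal_basis_of_def)
qed

lemma card_perp_basis:
  assumes "norm (\<xi> :: 'a::euclidean_space) = 1"
  shows "card (perp_basis \<xi>) = DIM('a) - 1"
proof -
  have "card (insert \<xi> (perp_basis \<xi>)) = DIM('a)"
    using orthonormal_basis_insert_perp[OF assms]
    by (metis orthonormal_basis_of_def dim_UNIV dim_span dim_eq_card_independent)
  then show ?thesis using not_mem_perp_basis[OF assms] by simp
qed

text \<open>Fubini's theorem in the orthonormal coordinates obtained by adjoining
  \<open>\<xi>\<close> to \<open>perp_basis \<xi>\<close>, with the coordinate of
  \<open>\<xi>\<close> integrated first.\<close>

lemma emeasure_lborel_perp_slices:
  fixes \<xi> :: "'a::euclidean_space"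
  assumes "norm \<xi> = 1" and [measurable]: "K \<in> sets borel"
  shows "emeasure lborel K =
    (\<integral>\<^sup>+f. emeasure lborel {t. perp_point \<xi> f + t *\<^sub>R \<xi> \<in> K} \<partial>(\<Pi>\<^sub>M b\<in>perp_basis \<xi>. lborel))"
proof -
  interpret product_sigma_finite "\<lambda>_::'a. lborel :: real measure" by standard
  let ?B = "perp_basis \<xi>" and ?C = "insert \<xi> (perp_basis \<xi>)"
  have n: "\<xi> \<notin> ?B" by (rule not_mem_perp_basis[OF assms(1)])
  define G where "G = (\<lambda>f::'a \<Rightarrow> real. \<Sum>c\<in>?C. f c *\<^sub>R c)"
  have [measurable]: "G \<in> measurable (\<Pi>\<^sub>M c\<in>?C. lborel) borel"
    unfolding G_def by measurable
  have G: "G (f(\<xi> := t)) = perp_point \<xi> f + t *\<^sub>R \<xi>" for f t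
  proof -
    have "(\<Sum>c\<in>?B. (f(\<xi> := t)) c *\<^sub>R c) = perp_point \<xi> f"
      unfolding perp_point_def using n by (intro sum.cong) auto
    then show ?thesis using n by (simp add: G_def)
  qed
  have "emeasure lborel K = emeasure (distr (\<Pi>\<^sub>M c\<in>?C. lborel) borel G) K"
    unfolding G_def using lborel_eq_orthonormal_basis[OF orthonormal_basis_insert_perp[OF assms(1)]]
    by simp
  also have "\<dots> = (\<integral>\<^sup>+f. indicator K (G f) \<partial>(\<Pi>\<^sub>M c\<in>?C. lborel))"
    by (subst nn_integral_distr[of G _ borel "indicator K", symmetric]) simp_all
  also have "\<dots> = (\<integral>\<^sup>+f. \<integral>\<^sup>+t. indicator K (G (f(\<xi> := t))) \<partial>lborel \<partial>(\<Pi>\<^sub>M b\<in>?B. lborel))"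
    using n by (intro product_nn_integral_insert) auto
  also have "\<dots> = (\<integral>\<^sup>+f. emeasure lborel {t. perp_point \<xi> f + t *\<^sub>R \<xi> \<in> K} \<partial>(\<Pi>\<^sub>M b\<in>?B. lborel))"
  proof (intro nn_integral_cong)
    fix f
    have "(\<integral>\<^sup>+t. indicator K (G (f(\<xi> := t))) \<partial>lborel) =
        (\<integral>\<^sup>+t. indicator {t. perp_point \<xi> f + t *\<^sub>R \<xi> \<in> K} t \<partial>lborel)"
      by (intro nn_integral_cong) (auto simp: G indicator_def)
    also have "\<dots> = emeasure lborel {t. perp_point \<xi> f + t *\<^sub>R \<xi> \<in> K}"
      by (intro nn_integral_indicator) measurable
    finally show "(\<integral>\<^sup>+t. indicator K (G (f(\<xi> := t))) \<partial>lborel) =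
        emeasure lborel {t. perp_point \<xi> f + t *\<^sub>R \<xi> \<in> K}" .
  qed
  finally show ?thesis .
qed

section \<open>Projection volumes and the effect of adding a segment\<close>

lemma linear_perp_proj: "linear (perp_proj \<xi>)"
  by (intro linearI)
    (simp_all add: perp_proj_def inner_add_left add_divide_distrib scaleR_add_left scaleR_diff_right)

lemma compact_perp_proj: "compact K \<Longrightarrow> compact (perp_proj \<xi> ` K)"
  by (intro compact_continuous_image linear_continuous_on) (simp_all add: linear_perp_proj linear_linear)

text \<open>Links the slicing formula to projections: the projection consists of the feet of the
  lines parallel to \<open>\<xi>\<close> whose slices are non-empty.\<close>

lemma perp_point_mem_perp_proj_iff:
  assumes "norm \<xi> = 1"
  shows "perp_point \<xi> f \<in> perp_proj \<xi> ` K \<longleftrightarrow> (\<exists>t. perp_point \<xi> f + t *\<^sub>R \<xi> \<in> K)"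
proof -
  have xx: "\<xi> \<bullet> \<xi> = 1" using assms by (simp add: norm_eq_1)
  have 1: "\<exists>t. perp_point \<xi> f + t *\<^sub>R \<xi> \<in> K" if pK: "perp_point \<xi> f \<in> perp_proj \<xi> ` K"
  proof -
    obtain x where "x \<in> K" "perp_point \<xi> f = perp_proj \<xi> x" using pK by (rule imageE) simp
    then show ?thesis by (intro exI[of _ "x \<bullet> \<xi>"]) (simp add: perp_proj_def xx)
  qed
  have 2: "perp_point \<xi> f \<in> perp_proj \<xi> ` K" if pK: "\<exists>t. perp_point \<xi> f + t *\<^sub>R \<xi> \<in> K"
  proof -
    obtain t where "perp_point \<xi> f + t *\<^sub>R \<xi> \<in> K" using pK by auto
    moreover have "perp_proj \<xi> (perp_point \<xi> f + t *\<^sub>R \<xi>) = perp_point \<xi> f"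
      by (simp add: perp_proj_def inner_add_left xx)
    ultimately show ?thesis by (metis imageI)
  qed
  show ?thesis using 1 2 by blast
qed

lemma emeasure_perp_proj_cball:
  fixes \<xi> :: "'a::euclidean_space"
  assumes "norm \<xi> = 1" "0 < r"
  shows "emeasure (subspace_lborel ({\<xi>}\<^sup>\<bottom>)) (perp_proj \<xi> ` cball 0 r) =
    ennreal (unit_ball_vol (real (DIM('a) - 1)) * r ^ (DIM('a) - 1))"
proof -
  have nrm: "norm (perp_point \<xi> f) = sqrt (\<Sum>b\<in>perp_basis \<xi>. (f b)\<^sup>2)" for f
  proof -
    have "(norm (perp_point \<xi> f))\<^sup>2 = (\<Sum>b\<in>perp_basis \<xi>. (norm (f b *\<^sub>R b))\<^sup>2)"
      unfolding perp_point_def using perp_basis[of \<xi>]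
      by (intro norm_sum_Pythagorean)
        (auto simp: pairwise_def orthogonal_def orthonormal_basis_of_inner)
    also have "\<dots> = (\<Sum>b\<in>perp_basis \<xi>. (f b)\<^sup>2)"
      using perp_basis[of \<xi>] by (intro sum.cong) (auto simp: orthonormal_basis_of_def)
    finally show ?thesis by (simp add: real_sqrt_unique)
  qed
  \<comment> \<open>By Pythagoras the foot is the point of its line nearest to the origin, so a line
    meets the ball exactly when its foot does. In coordinates the projected ball is therefore a
    Euclidean ball of one dimension less.\<close>
  have "norm (perp_point \<xi> f) \<le> norm (perp_point \<xi> f + t *\<^sub>R \<xi>)" for f t
  proof (rule power2_le_imp_le)
    have "orthogonal (perp_point \<xi> f) (t *\<^sub>R \<xi>)" by (simp add: orthogonal_def)
    then show "(norm (perp_point \<xi> f))\<^sup>2 \<le> (norm (perp_point \<xi> f + t *\<^sub>R \<xi>))\<^sup>2"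
      by (simp add: norm_add_Pythagorean)
  qed simp
  then have "(\<exists>t. perp_point \<xi> f + t *\<^sub>R \<xi> \<in> cball 0 r) \<longleftrightarrow> norm (perp_point \<xi> f) \<le> r" for f
    by (auto intro: exI[of _ 0] order_trans)
  then have "perp_point \<xi> -` (perp_proj \<xi> ` cball 0 r) = {f. sqrt (\<Sum>b\<in>perp_basis \<xi>. (f b)\<^sup>2) \<le> r}"
    by (simp only: vimage_def perp_point_mem_perp_proj_iff[OF assms(1)] nrm)
  then show ?thesis
    unfolding subspace_lborel_perp
    using compact_perp_proj[OF compact_cball[of 0 r], of \<xi>] assms
    by (simp add: emeasure_distr borel_compact emeasure_cball_aux card_perp_basis)
qed

text \<open>\<open>perp_proj_vol\<close> is defined by \<open>measure\<close>, which returns 0 on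
  sets of infinite measure; monotonicity and additivity depend on excluding that case.\<close>

lemma emeasure_perp_proj_finite:
  fixes K :: "'a::euclidean_space set"
  assumes "norm \<xi> = 1" "compact K"
  shows "emeasure (subspace_lborel ({\<xi>}\<^sup>\<bottom>)) (perp_proj \<xi> ` K) < \<infinity>"
proof -
  obtain r where r: "0 < r" "K \<subseteq> cball 0 r"
    using compact_imp_bounded[OF assms(2)] by (auto simp: bounded_pos subset_iff)
  have "emeasure (subspace_lborel ({\<xi>}\<^sup>\<bottom>)) (perp_proj \<xi> ` K) \<le>
      emeasure (subspace_lborel ({\<xi>}\<^sup>\<bottom>)) (perp_proj \<xi> ` cball 0 r)"
    using r compact_perp_proj[OF compact_cball[of 0 r], of \<xi>]
    by (intro emeasure_mono image_mono) (auto simp: subspace_lborel_perp borel_compact)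
  then show ?thesis
    using emeasure_perp_proj_cball[OF assms(1) r(1)] by (simp add: le_less_trans)
qed

lemma perp_proj_vol_cball:
  fixes \<xi> :: "'a::euclidean_space"
  assumes "norm \<xi> = 1" "0 < r"
  shows "perp_proj_vol \<xi> (cball 0 r) = unit_ball_vol (real (DIM('a) - 1)) * r ^ (DIM('a) - 1)"
  using emeasure_perp_proj_cball[OF assms] assms(2)
  by (simp add: perp_proj_vol_def measure_def enn2real_mult)

lemma perp_proj_vol_mono:
  fixes K :: "'a::euclidean_space set"
  assumes "norm \<xi> = 1" "compact K" "compact L" "K \<subseteq> L"
  shows "perp_proj_vol \<xi> K \<le> perp_proj_vol \<xi> L"
  unfolding perp_proj_vol_def
  using assms emeasure_perp_proj_finite[OF assms(1,3)] compact_perp_proj[of K \<xi>] compact_perp_proj[of L \<xi>]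
  by (intro measure_mono_fmeasurable image_mono) (auto simp: fmeasurable_def subspace_lborel_perp borel_compact)

lemma compact_set_plus:
  fixes S T :: "'a::real_normed_vector set"
  shows "compact S \<Longrightarrow> compact T \<Longrightarrow> compact (S + T)"
proof -
  have "S + T = (\<Union>x\<in>S. \<Union>y\<in>T. {x + y})" by (auto simp: set_plus_def)
  then show "compact S \<Longrightarrow> compact T \<Longrightarrow> compact (S + T)" using compact_sums'[of S T] by simp
qed

text \<open>By convexity every line parallel to \<open>\<xi>\<close> meets \<open>K\<close> in a
  compact interval or not at all. Adding the segment lengthens each non-empty slice by
  \<open>s\<close> and creates no new ones; integrating over the hyperplane gives \<open>s\<close>
  times the volume of the projection.\<close>

lemma emeasure_lborel_add_segment:
  fixes K :: "'a::euclidean_space set"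
  assumes K: "compact K" "convex K" and \<xi>: "norm \<xi> = 1" and s: "0 \<le> s"
  shows "emeasure lborel (K + closed_segment 0 (s *\<^sub>R \<xi>)) = emeasure lborel K +
    ennreal s * emeasure (subspace_lborel ({\<xi>}\<^sup>\<bottom>)) (perp_proj \<xi> ` K)"
proof -
  let ?P = "\<Pi>\<^sub>M b\<in>perp_basis \<xi>. (lborel :: real measure)"
  define L where "L = K + closed_segment 0 (s *\<^sub>R \<xi>)"
  have L: "compact L" unfolding L_def by (intro compact_set_plus K) auto
  have [measurable]: "K \<in> sets borel" "L \<in> sets borel" "perp_proj \<xi> ` K \<in> sets borel"
    using K L compact_perp_proj[OF K(1), of \<xi>] by (auto simp: borel_compact)
  have slice: "emeasure lborel {t. perp_point \<xi> f + t *\<^sub>R \<xi> \<in> L} =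
      emeasure lborel {t. perp_point \<xi> f + t *\<^sub>R \<xi> \<in> K} +
      ennreal s * indicator (perp_proj \<xi> ` K) (perp_point \<xi> f)" for f
  proof -
    let ?S = "\<lambda>A. {t. perp_point \<xi> f + t *\<^sub>R \<xi> \<in> A}"
    \<comment> \<open>Slicing commutes with the sum because the segment is parallel to the slicing
      lines: each slice of \<open>L\<close> is the slice of \<open>K\<close> plus
      \<open>[0, s]\<close>.\<close>
    have SL: "?S L = {t + u | t u. t \<in> ?S K \<and> 0 \<le> u \<and> u \<le> s}"
    proof safe
      fix t assume "perp_point \<xi> f + t *\<^sub>R \<xi> \<in> L"
      then obtain x v where x: "x \<in> K" and v: "0 \<le> v" "v \<le> 1"
        and eq: "perp_point \<xi> f + t *\<^sub>R \<xi> = x + v *\<^sub>R s *\<^sub>R \<xi>"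
        by (auto simp: L_def set_plus_def closed_segment_def)
      then have "perp_point \<xi> f + (t - v * s) *\<^sub>R \<xi> = x" by (simp add: algebra_simps)
      then show "\<exists>t' u. t = t' + u \<and> t' \<in> ?S K \<and> 0 \<le> u \<and> u \<le> s"
        using x v s by (intro exI[of _ "t - v * s"] exI[of _ "v * s"]) (auto simp: mult_left_le_one_le)
    next
      fix t u assume tu: "perp_point \<xi> f + t *\<^sub>R \<xi> \<in> K" "0 \<le> u" "u \<le> s"
      have "u *\<^sub>R \<xi> \<in> closed_segment 0 (s *\<^sub>R \<xi>)"
        using tu by (cases "s = 0") (auto simp: closed_segment_def intro!: exI[of _ "u / s"])
      then have "(perp_point \<xi> f + t *\<^sub>R \<xi>) + u *\<^sub>R \<xi> \<in> L"
        unfolding L_def using tu by blast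
      then show "perp_point \<xi> f + (t + u) *\<^sub>R \<xi> \<in> L" by (simp add: algebra_simps)
    qed
    show ?thesis
    proof (cases "?S K = {}")
      case True
      then have "?S L = {}" using SL by auto
      moreover have "perp_point \<xi> f \<notin> perp_proj \<xi> ` K"
        using True by (auto simp: perp_point_mem_perp_proj_iff[OF \<xi>])
      ultimately show ?thesis using True by simp
    next
      case False
      have eq: "?S K = (\<lambda>t. perp_point \<xi> f + t *\<^sub>R \<xi>) -` K" by auto
      have "bounded (?S K)"
      proof -
        obtain r where r: "\<forall>x\<in>K. norm x \<le> r" using compact_imp_bounded[OF K(1)] by (auto simp: bounded_iff)
        have "\<bar>t\<bar> \<le> r" if "t \<in> ?S K" for t
        proof -
          have "t = (perp_point \<xi> f + t *\<^sub>R \<xi>) \<bullet> \<xi>" using \<xi> by (simp add: inner_add_left norm_eq_1)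
          also have "\<bar>\<dots>\<bar> \<le> norm (perp_point \<xi> f + t *\<^sub>R \<xi>)"
            using Cauchy_Schwarz_ineq2[of _ \<xi>] \<xi> by simp
          finally show ?thesis using r that by force
        qed
        then show ?thesis by (auto simp: bounded_iff)
      qed
      moreover have "closed (?S K)"
        unfolding eq using K by (intro closed_vimage continuous_intros) (auto simp: compact_imp_closed)
      moreover have "connected (?S K)"
      proof -
        have "convex (?S K)"
        proof (rule convexI)
          fix x y u v :: real assume a: "x \<in> ?S K" "y \<in> ?S K" "0 \<le> u" "0 \<le> v" "u + v = 1"
          have "perp_point \<xi> f + (u *\<^sub>R x + v *\<^sub>R y) *\<^sub>R \<xi> =
              (u + v) *\<^sub>R perp_point \<xi> f + (u *\<^sub>R x + v *\<^sub>R y) *\<^sub>R \<xi>" using a by simp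
          also have "\<dots> = u *\<^sub>R (perp_point \<xi> f + x *\<^sub>R \<xi>) + v *\<^sub>R (perp_point \<xi> f + y *\<^sub>R \<xi>)"
            by (simp add: algebra_simps)
          also have "\<dots> \<in> K" using a K(2) by (auto intro: convexD)
          finally show "u *\<^sub>R x + v *\<^sub>R y \<in> ?S K" by simp
        qed
        then show ?thesis by (rule convex_connected)
      qed
      ultimately obtain a b where ab: "?S K = {a..b}"
        using connected_compact_interval_1[of "?S K"] by (auto simp: compact_eq_bounded_closed)
      with False have "a \<le> b" by auto
      have "?S L = {a..b + s}"
      proof (intro equalityI subsetI)
        fix x assume "x \<in> ?S L" then show "x \<in> {a..b + s}" unfolding SL ab by auto
      next
        fix x assume x: "x \<in> {a..b + s}"
        \<comment> \<open>\<open>min x b\<close> is the point of \<open>{a..b}\<close> closest to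
          \<open>x\<close>.\<close>
        have "x = min x b + (x - min x b)" by simp
        moreover have "min x b \<in> {a..b}" "0 \<le> x - min x b" "x - min x b \<le> s"
          using x \<open>a \<le> b\<close> s by auto
        ultimately show "x \<in> ?S L" unfolding SL ab by blast
      qed
      moreover have "perp_point \<xi> f \<in> perp_proj \<xi> ` K"
        using False by (auto simp: perp_point_mem_perp_proj_iff[OF \<xi>])
      ultimately show ?thesis using \<open>a \<le> b\<close> s ab
        by (simp add: ennreal_plus[symmetric] algebra_simps del: ennreal_plus)
    qed
  qed
  have m: "(\<lambda>f. emeasure lborel {t. perp_point \<xi> f + t *\<^sub>R \<xi> \<in> K}) \<in> borel_measurable ?P"
  proof -
    have "(\<lambda>f. emeasure lborel {t \<in> space lborel. perp_point \<xi> f + t *\<^sub>R \<xi> \<in> K}) \<in> borel_measurable ?P"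
      by measurable
    then show ?thesis by simp
  qed
  have "emeasure lborel L = (\<integral>\<^sup>+f. (emeasure lborel {t. perp_point \<xi> f + t *\<^sub>R \<xi> \<in> K} +
      ennreal s * indicator (perp_proj \<xi> ` K) (perp_point \<xi> f)) \<partial>?P)"
    by (subst emeasure_lborel_perp_slices[OF \<xi>]) (simp_all add: slice)
  also have "\<dots> = emeasure lborel K + ennreal s * (\<integral>\<^sup>+f. indicator (perp_proj \<xi> ` K) (perp_point \<xi> f) \<partial>?P)"
    using m by (subst nn_integral_add)
      (simp_all add: nn_integral_cmult emeasure_lborel_perp_slices[OF \<xi>, of K])
  also have "(\<integral>\<^sup>+f. indicator (perp_proj \<xi> ` K) (perp_point \<xi> f) \<partial>?P) =
      emeasure (subspace_lborel ({\<xi>}\<^sup>\<bottom>)) (perp_proj \<xi> ` K)"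
    unfolding subspace_lborel_perp
    by (subst nn_integral_distr[of "perp_point \<xi>" _ borel "indicator (perp_proj \<xi> ` K)", symmetric])
      simp_all
  finally show ?thesis by (simp add: L_def)
qed

lemma measure_lebesgue_add_segment:
  fixes K :: "'a::euclidean_space set"
  assumes K: "compact K" "convex K" and \<xi>: "norm \<xi> = 1" and s: "0 \<le> s"
  shows "measure lebesgue (K + closed_segment 0 (s *\<^sub>R \<xi>)) = measure lebesgue K + s * perp_proj_vol \<xi> K"
proof -
  have L: "compact (K + closed_segment 0 (s *\<^sub>R \<xi>))" by (intro compact_set_plus K) auto
  have fin: "emeasure lborel K < \<infinity>" using K(1) emeasure_bounded_finite compact_imp_bounded by auto
  have fin2: "emeasure (subspace_lborel ({\<xi>}\<^sup>\<bottom>)) (perp_proj \<xi> ` K) < \<infinity>"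
    using emeasure_perp_proj_finite[OF \<xi> K(1)] .
  have "measure lborel (K + closed_segment 0 (s *\<^sub>R \<xi>)) = measure lborel K + s * perp_proj_vol \<xi> K"
    using emeasure_lborel_add_segment[OF assms] fin fin2 s
    by (simp add: measure_def perp_proj_vol_def enn2real_plus enn2real_mult ennreal_mult_less_top)
  then show ?thesis using K L by (simp add: borel_compact)
qed

subsection \<open>The Brunn--Minkowski inequality\<close>

text \<open>This is the Brunn--Minkowski inequality for boxes, with \<open>p\<close> and
  \<open>q\<close> as side lengths. Dividing by the right-hand side turns the factors into ratios
  \<open>p / (p + q)\<close> and \<open>q / (p + q)\<close>; AM-GM bounds each geometric mean, and
  the ratios add up to 1 in every coordinate.\<close>

lemma root_prod_add_le:
  fixes p q :: "'a \<Rightarrow> real"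
  assumes S: "finite S" "S \<noteq> {}" and p: "\<And>i. i \<in> S \<Longrightarrow> 0 < p i" and q: "\<And>i. i \<in> S \<Longrightarrow> 0 < q i"
  shows "root (card S) (\<Prod>i\<in>S. p i) + root (card S) (\<Prod>i\<in>S. q i) \<le> root (card S) (\<Prod>i\<in>S. p i + q i)"
proof -
  have n: "0 < card S" using S by (simp add: card_gt_0_iff)
  define r where "r = root (card S) (\<Prod>i\<in>S. p i + q i)"
  have "0 < (\<Prod>i\<in>S. p i + q i)" using p q by (intro prod_pos) (simp add: add_pos_pos)
  then have r: "0 < r" using n by (simp add: r_def)
  have amgm: "root (card S) (\<Prod>i\<in>S. f i) / r \<le> (\<Sum>i\<in>S. f i / (p i + q i) / card S)"
    if f: "\<And>i. i \<in> S \<Longrightarrow> 0 < f i" for f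
  proof -
    have nn: "0 \<le> f i / (p i + q i)" if "i \<in> S" for i
      using f[OF that] p[OF that] q[OF that] by simp
    have "root (card S) (\<Prod>i\<in>S. f i) / r = root (card S) (\<Prod>i\<in>S. f i / (p i + q i))"
      by (simp add: r_def real_root_divide prod_dividef)
    also have "\<dots> = (\<Prod>i\<in>S. f i / (p i + q i)) powr (1 / card S)"
      using n nn by (intro root_powr_inverse) (auto intro: prod_nonneg)
    also have "\<dots> \<le> (\<Sum>i\<in>S. f i / (p i + q i) / card S)"
      using S nn by (intro arith_geom_mean) auto
    finally show ?thesis .
  qed
  have "root (card S) (\<Prod>i\<in>S. p i) / r + root (card S) (\<Prod>i\<in>S. q i) / r \<le>
      (\<Sum>i\<in>S. p i / (p i + q i) / card S) + (\<Sum>i\<in>S. q i / (p i + q i) / card S)"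
    using amgm[of p] amgm[of q] p q by (intro add_mono) auto
  also have "\<dots> = (\<Sum>i\<in>S. 1 / card S)"
    unfolding sum.distrib[symmetric]
  proof (intro sum.cong refl)
    fix i assume "i \<in> S"
    then have "0 < p i + q i" using p q by (simp add: add_pos_pos)
    then show "p i / (p i + q i) / card S + q i / (p i + q i) / card S = 1 / card S"
      by (simp add: add_divide_distrib[symmetric])
  qed
  also have "\<dots> = 1" using n by simp
  finally have "(root (card S) (\<Prod>i\<in>S. p i) + root (card S) (\<Prod>i\<in>S. q i)) / r \<le> 1"
    by (simp add: add_divide_distrib)
  then show ?thesis using r by (simp add: r_def)
qed

lemma open_set_plus: "open A \<Longrightarrow> open (A + B :: 'a::real_normed_vector set)"
proof -
  have "A + B = (\<Union>x\<in>A. \<Union>y\<in>B. {x + y})" by (auto simp: set_plus_def)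
  then show "open A \<Longrightarrow> open (A + B)" using open_sums[of A B] by simp
qed

lemma bounded_set_plus: "bounded A \<Longrightarrow> bounded B \<Longrightarrow> bounded (A + B :: 'a::real_normed_vector set)"
proof -
  have "A + B = (\<Union>x\<in>A. \<Union>y\<in>B. {x + y})" by (auto simp: set_plus_def)
  then show "bounded A \<Longrightarrow> bounded B \<Longrightarrow> bounded (A + B)" using bounded_sums[of A B] by simp
qed

lemma set_plus_boxes:
  fixes a b c d :: "'a::euclidean_space"
  assumes "box a b \<noteq> {}" "box c d \<noteq> {}"
  shows "box (a + c) (b + d) \<subseteq> box a b + box c d"
proof
  fix x assume x: "x \<in> box (a + c) (b + d)"
  \<comment> \<open>The relative position of \<open>x\<close> in the sum interval of each
    coordinate. The summands \<open>y\<close> and \<open>z\<close> take the same relative position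
    in their own boxes.\<close>
  define t where "t = (\<lambda>i. (x \<bullet> i - a \<bullet> i - c \<bullet> i) / ((b \<bullet> i - a \<bullet> i) + (d \<bullet> i - c \<bullet> i)))"
  define y where "y = (\<Sum>i\<in>Basis. (a \<bullet> i + t i * (b \<bullet> i - a \<bullet> i)) *\<^sub>R i)"
  define z where "z = (\<Sum>i\<in>Basis. (c \<bullet> i + t i * (d \<bullet> i - c \<bullet> i)) *\<^sub>R i)"
  have t: "0 < t i" "t i < 1" "x \<bullet> i = a \<bullet> i + c \<bullet> i + t i * ((b \<bullet> i - a \<bullet> i) + (d \<bullet> i - c \<bullet> i))"
    and ab: "a \<bullet> i < b \<bullet> i" "c \<bullet> i < d \<bullet> i"
    if i: "i \<in> Basis" for i
  proof -
    show ab: "a \<bullet> i < b \<bullet> i" "c \<bullet> i < d \<bullet> i"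
      using assms i by (auto simp: box_ne_empty)
    have x': "a \<bullet> i + c \<bullet> i < x \<bullet> i" "x \<bullet> i < b \<bullet> i + d \<bullet> i"
      using x i by (auto simp: mem_box inner_add_left)
    have pos: "0 < (b \<bullet> i - a \<bullet> i) + (d \<bullet> i - c \<bullet> i)" using ab by simp
    show "0 < t i" "t i < 1" unfolding t_def using x' pos by (simp_all add: pos_less_divide_eq pos_divide_less_eq)
    show "x \<bullet> i = a \<bullet> i + c \<bullet> i + t i * ((b \<bullet> i - a \<bullet> i) + (d \<bullet> i - c \<bullet> i))"
      unfolding t_def using pos by simp
  qed
  have yz: "y \<bullet> i = a \<bullet> i + t i * (b \<bullet> i - a \<bullet> i)" "z \<bullet> i = c \<bullet> i + t i * (d \<bullet> i - c \<bullet> i)"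
    if "i \<in> Basis" for i
    using that by (simp_all add: y_def z_def inner_sum_left inner_Basis if_distrib cong: if_cong)
  have lt: "u + s * (v - u) < v" if "s < 1" "u < v" for s u v :: real
  proof -
    have "s * (v - u) < 1 * (v - u)" using that by (intro mult_strict_right_mono) auto
    then show ?thesis by simp
  qed
  have "y \<in> box a b" "z \<in> box c d"
    using t ab by (auto simp: mem_box yz lt)
  moreover have "x = y + z"
    by (rule euclidean_eqI) (simp add: t(3) yz inner_add_left algebra_simps)
  ultimately show "x \<in> box a b + box c d" by blast
qed

lemma brunn_minkowski_box:
  fixes a b c d :: "'a::euclidean_space"
  assumes ne: "box a b \<noteq> {}" "box c d \<noteq> {}"
  shows "root DIM('a) (measure lebesgue (box a b)) + root DIM('a) (measure lebesgue (box c d)) \<le>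
    root DIM('a) (measure lebesgue (box a b + box c d))"
proof -
  have ab: "a \<bullet> i < b \<bullet> i" "c \<bullet> i < d \<bullet> i" if "i \<in> Basis" for i
    using ne that by (auto simp: box_ne_empty)
  have m: "measure lebesgue (box u v) = (\<Prod>i\<in>Basis. v \<bullet> i - u \<bullet> i)" if "\<And>i. i \<in> Basis \<Longrightarrow> u \<bullet> i < v \<bullet> i"
    for u v :: 'a
    using that by (simp add: measure_lborel_box_eq less_imp_le inner_diff_left)
  have "root DIM('a) (measure lebesgue (box a b)) + root DIM('a) (measure lebesgue (box c d)) \<le>
      root DIM('a) (measure lebesgue (box (a + c) (b + d)))"
  proof -
    have "measure lebesgue (box (a + c) (b + d)) = (\<Prod>i\<in>Basis. (b + d) \<bullet> i - (a + c) \<bullet> i)"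
      using ab by (intro m) (simp add: inner_add_left add_strict_mono)
    also have "\<dots> = (\<Prod>i\<in>Basis. (b \<bullet> i - a \<bullet> i) + (d \<bullet> i - c \<bullet> i))"
      by (simp add: inner_add_left algebra_simps)
    finally have mac: "measure lebesgue (box (a + c) (b + d)) = (\<Prod>i\<in>Basis. (b \<bullet> i - a \<bullet> i) + (d \<bullet> i - c \<bullet> i))" .
    have mab: "measure lebesgue (box a b) = (\<Prod>i\<in>Basis. b \<bullet> i - a \<bullet> i)"
      "measure lebesgue (box c d) = (\<Prod>i\<in>Basis. d \<bullet> i - c \<bullet> i)"
      using ab by (intro m; simp)+
    show ?thesis
      unfolding mac mab
      using root_prod_add_le[of "Basis :: 'a set" "\<lambda>i. b \<bullet> i - a \<bullet> i" "\<lambda>i. d \<bullet> i - c \<bullet> i"] ab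
      by (simp del: measure_completion)
  qed
  also have "\<dots> \<le> root DIM('a) (measure lebesgue (box a b + box c d))"
    using set_plus_boxes[OF ne]
    by (intro iffD2[OF real_root_le_iff] measure_mono_fmeasurable lmeasurable_open)
      (auto intro!: open_set_plus bounded_set_plus)
  finally show ?thesis .
qed

section \<open>Cutting open sets by coordinate hyperplanes\<close>

text \<open>Pushing the volume of \<open>A\<close> forward along the coordinate \<open>k\<close>
  gives a finite measure on the line. Its distribution function is continuous and runs from 0 to the
  volume of \<open>A\<close>, so the intermediate value theorem finds the cut.\<close>

lemma halfspace_volume_fraction:
  fixes A :: "'a::euclidean_space set"
  assumes A: "open A" "bounded A" and k: "k \<in> Basis" and \<theta>: "0 < \<theta>" "\<theta> < 1" "0 < measure lebesgue A"
  obtains c where "measure lebesgue (A \<inter> {x. x \<bullet> k < c}) = \<theta> * measure lebesgue A"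
    "measure lebesgue (A \<inter> {x. c < x \<bullet> k}) = (1 - \<theta>) * measure lebesgue A"
proof -
  have [measurable]: "A \<in> sets borel" using A by auto
  define M where "M = distr (restrict_space lborel A) borel (\<lambda>x. x \<bullet> k)"
  have Afin: "emeasure lborel A < \<infinity>" using A(2) emeasure_bounded_finite by auto
  have meas [measurable]: "(\<lambda>x. x \<bullet> k) \<in> measurable (restrict_space lborel A) borel"
    by (intro measurable_restrict_space1) simp
  have M: "emeasure M S = emeasure lborel (A \<inter> {x. x \<bullet> k \<in> S})" if "S \<in> sets borel" for S
  proof -
    have "emeasure M S = emeasure (restrict_space lborel A) ((\<lambda>x. x \<bullet> k) -` S \<inter> A)"
      using that by (simp add: M_def emeasure_distr space_restrict_space)
    also have "\<dots> = emeasure lborel ((\<lambda>x. x \<bullet> k) -` S \<inter> A)"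
      by (intro emeasure_restrict_space) auto
    finally show ?thesis by (simp add: vimage_def Int_commute)
  qed
  interpret finite_borel_measure M
  proof (intro finite_borel_measure.intro finite_borel_measure_axioms.intro finite_measureI)
    show "emeasure M (space M) \<noteq> \<infinity>"
      using M[of UNIV] Afin by (simp add: M_def)
  qed (simp add: M_def)
  have hyp: "negligible {x. x \<bullet> k = c}" for c
    using negligible_standard_hyperplane[OF k, of c] .
  have meas': "measure M S = measure lebesgue (A \<inter> {x. x \<bullet> k \<in> S})" if "S \<in> sets borel" for S
  proof -
    have "{x. x \<bullet> k \<in> S} = (\<lambda>x. x \<bullet> k) -` S \<inter> space borel" by auto
    also have "\<dots> \<in> sets borel" using that by (intro measurable_sets) auto
    finally show ?thesis using that by (simp add: measure_def M)
  qed
  \<comment> \<open>Hyperplanes are null, so there are no atoms. This gives continuity of the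
    distribution function, and later lets open and closed half-lines be exchanged.\<close>
  have atom: "measure M {c} = 0" for c
    using negligible_subset[OF hyp[of c], of "A \<inter> {x. x \<bullet> k = c}"]
    by (simp add: meas' negligible_imp_measure0 del: measure_completion)
  have cont: "isCont (cdf M) x" for x by (simp add: isCont_cdf atom)
  let ?v = "\<theta> * measure lebesgue A"
  have tot: "measure M (space M) = measure lebesgue A"
    using meas'[of UNIV] by (simp add: M_def)
  have "\<forall>\<^sub>F x in at_bot. cdf M x < ?v"
    using cdf_lim_at_bot \<theta> by (intro order_tendstoD(2)) auto
  then obtain x1 where x1: "cdf M x1 < ?v" by (auto simp: eventually_at_bot_linorder)
  have "\<forall>\<^sub>F x in at_top. ?v < cdf M x"
    using cdf_lim_at_top \<theta> by (intro order_tendstoD(1)) (auto simp: tot)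
  then obtain x2 where x2: "?v < cdf M x2" by (auto simp: eventually_at_top_linorder)
  have "x1 \<le> x2" using x1 x2 cdf_nondecreasing[of x2 x1] by linarith
  then obtain c where c: "cdf M c = ?v"
    using IVT[of "cdf M" x1 ?v x2] x1 x2 cont by auto
  have "{..c} = {..<c} \<union> {c}" by auto
  then have "measure M {..c} = measure M {..<c} + measure M {c}"
    by (simp only:) (intro finite_measure_Union, auto simp: M_def)
  then have 1: "measure M {..<c} = ?v" using c atom by (simp add: cdf_def)
  have "space M = {..c} \<union> {c<..}" by (auto simp: M_def)
  then have "measure M (space M) = measure M {..c} + measure M {c<..}"
    by (simp only:) (intro finite_measure_Union, auto simp: M_def)
  then have 2: "measure M {c<..} = (1 - \<theta>) * measure lebesgue A"
    using c by (simp add: tot cdf_def algebra_simps)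
  show ?thesis
    using 1 2 by (intro that[of c]) (simp_all add: meas')
qed

lemma measure_halfspace_split:
  fixes A :: "'a::euclidean_space set"
  assumes A: "open A" "bounded A" and k: "k \<in> Basis"
  shows "measure lebesgue A = measure lebesgue (A \<inter> {x. x \<bullet> k < c}) + measure lebesgue (A \<inter> {x. c < x \<bullet> k})"
proof -
  have op: "open (A \<inter> {x. x \<bullet> k < c})" "open (A \<inter> {x. c < x \<bullet> k})"
    using A by (auto intro!: open_Int open_halfspace_component_lt open_halfspace_component_gt)
  have hyp: "negligible {x. x \<bullet> k = c}"
    using negligible_standard_hyperplane[OF k, of c] .
  have "measure lebesgue A = measure lebesgue (A \<inter> {x. x \<bullet> k < c}) + measure lebesgue (A \<inter> {x. c < x \<bullet> k})
      + measure lebesgue (A \<inter> {x. x \<bullet> k = c})"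
  proof (rule measure_Un3_negligible)
    show "A \<inter> {x. x \<bullet> k < c} \<in> lmeasurable" "A \<inter> {x. c < x \<bullet> k} \<in> lmeasurable"
      using A op by (simp_all add: lmeasurable_open bounded_Int)
    show "A \<inter> {x. x \<bullet> k = c} \<in> lmeasurable"
      using negligible_subset[OF hyp, of "A \<inter> {x. x \<bullet> k = c}"] by (simp add: negligible_imp_measurable)
    have "A \<inter> {x. x \<bullet> k < c} \<inter> (A \<inter> {x. c < x \<bullet> k}) = {}"
      "A \<inter> {x. x \<bullet> k < c} \<inter> (A \<inter> {x. x \<bullet> k = c}) = {}"
      "A \<inter> {x. c < x \<bullet> k} \<inter> (A \<inter> {x. x \<bullet> k = c}) = {}" by auto
    then show "negligible (A \<inter> {x. x \<bullet> k < c} \<inter> (A \<inter> {x. c < x \<bullet> k}))"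
      "negligible (A \<inter> {x. x \<bullet> k < c} \<inter> (A \<inter> {x. x \<bullet> k = c}))"
      "negligible (A \<inter> {x. c < x \<bullet> k} \<inter> (A \<inter> {x. x \<bullet> k = c}))" by (metis negligible_empty)+
  qed auto
  then show ?thesis
    using negligible_subset[OF hyp, of "A \<inter> {x. x \<bullet> k = c}"] by (simp add: negligible_imp_measure0)
qed

section \<open>Brunn--Minkowski for finite unions of boxes\<close>

text \<open>Open boxes may share a face and still be disjoint, and their union is open.
  Non-emptiness makes two members separable by a hyperplane and every union of positive
  volume.\<close>

definition box_family :: "'a::euclidean_space set set \<Rightarrow> bool" where
  "box_family F \<longleftrightarrow> finite F \<and> F \<noteq> {} \<and> pairwise disjnt F \<and> (\<forall>b\<in>F. b \<noteq> {} \<and> (\<exists>l u. b = box l u))"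

lemma box_family_Union:
  assumes "box_family F"
  shows "open (\<Union>F)" "bounded (\<Union>F)" "\<Union>F \<noteq> {}"
proof -
  show "open (\<Union>F)" using assms by (intro open_Union) (auto simp: box_family_def)
  show "bounded (\<Union>F)" using assms by (intro bounded_Union) (auto simp: box_family_def)
  show "\<Union>F \<noteq> {}" using assms unfolding box_family_def by blast
qed

lemma measure_open_pos:
  fixes A :: "'a::euclidean_space set"
  assumes "open A" "bounded A" "A \<noteq> {}"
  shows "0 < measure lebesgue A"
proof -
  have "measure lebesgue A \<noteq> 0"
    using assms by (metis lmeasurable_open negligible_iff_measure open_not_negligible)
  then show ?thesis by (simp add: less_le)
qed

text \<open>The cardinality bound counts only boxes that meet \<open>H\<close>. A box lying on the
  other side of the cut drops out, which is what makes the later induction descend.\<close>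

lemma box_family_Int:
  fixes F :: "'a::euclidean_space set set"
  assumes F: "box_family F" and H: "\<And>l u. \<exists>l' u'. box l u \<inter> H = box l' u'" and ne: "\<Union>F \<inter> H \<noteq> {}"
  obtains F' where "box_family F'" "\<Union>F' = \<Union>F \<inter> H" "card F' \<le> card {b \<in> F. b \<inter> H \<noteq> {}}"
proof
  define F' where "F' = (\<lambda>b. b \<inter> H) ` {b \<in> F. b \<inter> H \<noteq> {}}"
  have fin: "finite F" using F by (simp add: box_family_def)
  show "box_family F'"
    unfolding box_family_def
  proof (intro conjI)
    show "finite F'" using fin by (simp add: F'_def)
    show "F' \<noteq> {}" using ne by (auto simp: F'_def)
    show "pairwise disjnt F'"
      using F unfolding box_family_def F'_def pairwise_def disjnt_def by blast
    show "\<forall>b\<in>F'. b \<noteq> {} \<and> (\<exists>l u. b = box l u)"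
      using F H unfolding box_family_def F'_def by fastforce
  qed
  show "\<Union>F' = \<Union>F \<inter> H" by (auto simp: F'_def)
  show "card F' \<le> card {b \<in> F. b \<inter> H \<noteq> {}}"
    unfolding F'_def using fin by (intro card_image_le) auto
qed

lemma box_Int_halfspace:
  fixes k :: "'a::euclidean_space"
  assumes k: "k \<in> Basis"
  shows "\<exists>l' u'. box l u \<inter> {x. x \<bullet> k < c} = box l' u'" "\<exists>l' u'. box l u \<inter> {x. c < x \<bullet> k} = box l' u'"
proof -
  have "box l u \<inter> {x. x \<bullet> k < c} = box l (u + (min (u \<bullet> k) c - u \<bullet> k) *\<^sub>R k)"
    using k by (auto simp: mem_box inner_add_left inner_Basis split: if_splits)
  then show "\<exists>l' u'. box l u \<inter> {x. x \<bullet> k < c} = box l' u'" by blast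
  have "box l u \<inter> {x. c < x \<bullet> k} = box (l + (max (l \<bullet> k) c - l \<bullet> k) *\<^sub>R k) u"
    using k by (auto simp: mem_box inner_add_left inner_Basis split: if_splits)
  then show "\<exists>l' u'. box l u \<inter> {x. c < x \<bullet> k} = box l' u'" by blast
qed

text \<open>Disjoint non-empty boxes have disjoint sides in some coordinate. The level is the upper
  end of the lower side; since the boxes are open, both stay strictly on their sides of it.\<close>

lemma disjoint_boxes_separated:
  fixes a b c d :: "'a::euclidean_space"
  assumes ne: "box a b \<noteq> {}" "box c d \<noteq> {}" and disj: "box a b \<inter> box c d = {}"
  obtains k s where "k \<in> Basis" "box a b \<subseteq> {x. x \<bullet> k < s} \<and> box c d \<subseteq> {x. s < x \<bullet> k} \<or>
      box c d \<subseteq> {x. x \<bullet> k < s} \<and> box a b \<subseteq> {x. s < x \<bullet> k}"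
proof -
  obtain k where k: "k \<in> Basis" "b \<bullet> k \<le> a \<bullet> k \<or> d \<bullet> k \<le> c \<bullet> k \<or> b \<bullet> k \<le> c \<bullet> k \<or> d \<bullet> k \<le> a \<bullet> k"
    using disj by (auto simp: disjoint_interval)
  with ne have "b \<bullet> k \<le> c \<bullet> k \<or> d \<bullet> k \<le> a \<bullet> k"
    by (auto simp: box_ne_empty not_le)
  then show ?thesis
  proof
    assume "b \<bullet> k \<le> c \<bullet> k"
    then show ?thesis using k(1) by (intro that[of k "b \<bullet> k"]) (force simp: mem_box)+
  next
    assume "d \<bullet> k \<le> a \<bullet> k"
    then show ?thesis using k(1) by (intro that[of k "d \<bullet> k"]) (force simp: mem_box)+
  qed
qed

text \<open>
  Hadwiger--Ohmann: cut one family by a coordinate hyperplane separating two of its boxes and the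
  other one by a parallel hyperplane in the same volume ratio; the sums of corresponding halves are
  disjoint and involve fewer boxes.
\<close>

lemma brunn_minkowski_box_family:
  fixes F G :: "'a::euclidean_space set set"
  assumes "box_family F" "box_family G"
  shows "root DIM('a) (measure lebesgue (\<Union>F)) + root DIM('a) (measure lebesgue (\<Union>G)) \<le>
    root DIM('a) (measure lebesgue (\<Union>F + \<Union>G))"
  using assms
proof (induction "card F + card G" arbitrary: F G rule: less_induct)
  case less
  let ?n = "DIM('a)" and ?m = "measure lebesgue :: 'a set \<Rightarrow> real"
  \<comment> \<open>The argument is asymmetric, as \<open>F\<close> is the family cut between two of
    its boxes. It is proved for arbitrary families with its own induction hypothesis so that it also
    covers the case with the roles exchanged.\<close>
  have step: "root ?n (?m (\<Union>F)) + root ?n (?m (\<Union>G)) \<le> root ?n (?m (\<Union>F + \<Union>G))"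
    if F: "box_family F" and G: "box_family G" and c: "2 \<le> card F"
      and IH: "\<And>F' G' :: 'a set set. card F' + card G' < card F + card G \<Longrightarrow> box_family F' \<Longrightarrow> box_family G' \<Longrightarrow>
        root ?n (?m (\<Union>F')) + root ?n (?m (\<Union>G')) \<le> root ?n (?m (\<Union>F' + \<Union>G'))"
    for F G :: "'a set set"
  proof -
    have fin: "finite F" "finite G" using F G by (auto simp: box_family_def)
    obtain P Q where PQ: "P \<in> F" "Q \<in> F" "P \<noteq> Q"
      using c fin by (metis card_le_Suc0_iff_eq not_less_eq_eq numeral_2_eq_2)
    then obtain a b c' d where P: "P = box a b" and Q: "Q = box c' d"
      and ne: "P \<noteq> {}" "Q \<noteq> {}" and disj: "P \<inter> Q = {}"
      using F unfolding box_family_def pairwise_def disjnt_def by meson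
    obtain k s where k: "k \<in> Basis" and sep: "P \<subseteq> {x. x \<bullet> k < s} \<and> Q \<subseteq> {x. s < x \<bullet> k} \<or>
        Q \<subseteq> {x. x \<bullet> k < s} \<and> P \<subseteq> {x. s < x \<bullet> k}"
      using disjoint_boxes_separated[of a b c' d] ne disj unfolding P Q by metis
    let ?L = "\<lambda>s. {x::'a. x \<bullet> k < s}" and ?R = "\<lambda>s. {x::'a. s < x \<bullet> k}"
    have neF: "\<Union>F \<inter> ?L s \<noteq> {}" "\<Union>F \<inter> ?R s \<noteq> {}"
      using sep PQ ne by blast+
    obtain F1 where F1: "box_family F1" "\<Union>F1 = \<Union>F \<inter> ?L s" "card F1 \<le> card {b \<in> F. b \<inter> ?L s \<noteq> {}}"
      by (rule box_family_Int[OF F box_Int_halfspace(1)[OF k] neF(1)]) (rule that)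
    obtain F2 where F2: "box_family F2" "\<Union>F2 = \<Union>F \<inter> ?R s" "card F2 \<le> card {b \<in> F. b \<inter> ?R s \<noteq> {}}"
      by (rule box_family_Int[OF F box_Int_halfspace(2)[OF k] neF(2)]) (rule that)
    \<comment> \<open>Each half-space misses one of the two separated boxes, so both halves of
      \<open>F\<close> have strictly fewer members.\<close>
    have "P \<inter> ?L s = {} \<or> Q \<inter> ?L s = {}" "P \<inter> ?R s = {} \<or> Q \<inter> ?R s = {}"
      using sep by force+
    then have "{b \<in> F. b \<inter> ?L s \<noteq> {}} \<subset> F" "{b \<in> F. b \<inter> ?R s \<noteq> {}} \<subset> F" using PQ by blast+
    then have cF: "card F1 < card F" "card F2 < card F"
      using F1(3) F2(3) fin by (meson le_less_trans psubset_card_mono)+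
    note oF = box_family_Union[OF F] and oG = box_family_Union[OF G]
    define \<theta> where "\<theta> = ?m (\<Union>F1) / ?m (\<Union>F)"
    have pF: "0 < ?m (\<Union>F)" "0 < ?m (\<Union>F1)" "0 < ?m (\<Union>F2)" "0 < ?m (\<Union>G)"
      by (intro measure_open_pos box_family_Union F G F1(1) F2(1))+
    have sumF: "?m (\<Union>F) = ?m (\<Union>F1) + ?m (\<Union>F2)"
      unfolding F1(2) F2(2) by (rule measure_halfspace_split[OF oF(1,2) k])
    have \<theta>: "0 < \<theta>" "\<theta> < 1" "?m (\<Union>F1) = \<theta> * ?m (\<Union>F)" "?m (\<Union>F2) = (1 - \<theta>) * ?m (\<Union>F)"
    proof -
      show "0 < \<theta>" using pF by (simp add: \<theta>_def del: measure_completion)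
      show "\<theta> < 1" unfolding \<theta>_def using pF sumF by (intro divide_less_eq_1_pos[THEN iffD2]) linarith+
      show 1: "?m (\<Union>F1) = \<theta> * ?m (\<Union>F)" unfolding \<theta>_def using pF(1) by (simp del: measure_completion)
      show "?m (\<Union>F2) = (1 - \<theta>) * ?m (\<Union>F)" using 1 sumF by (simp add: left_diff_distrib del: measure_completion)
    qed
    obtain t where t: "?m (\<Union>G \<inter> ?L t) = \<theta> * ?m (\<Union>G)" "?m (\<Union>G \<inter> ?R t) = (1 - \<theta>) * ?m (\<Union>G)"
      by (rule halfspace_volume_fraction[OF oG(1,2) k \<theta>(1,2) pF(4)]) (rule that)
    have neG: "\<Union>G \<inter> ?L t \<noteq> {}" "\<Union>G \<inter> ?R t \<noteq> {}"
      using t \<theta> pF(4) by force+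
    obtain G1 where G1: "box_family G1" "\<Union>G1 = \<Union>G \<inter> ?L t" "card G1 \<le> card {b \<in> G. b \<inter> ?L t \<noteq> {}}"
      by (rule box_family_Int[OF G box_Int_halfspace(1)[OF k] neG(1)]) (rule that)
    obtain G2 where G2: "box_family G2" "\<Union>G2 = \<Union>G \<inter> ?R t" "card G2 \<le> card {b \<in> G. b \<inter> ?R t \<noteq> {}}"
      by (rule box_family_Int[OF G box_Int_halfspace(2)[OF k] neG(2)]) (rule that)
    \<comment> \<open>The cut through \<open>G\<close> is dictated by volume and need not remove any
      box; it is enough that the count does not grow.\<close>
    have cG: "card G1 \<le> card G" "card G2 \<le> card G"
      using G1(3) G2(3) fin(2) card_mono[of G "{b \<in> G. b \<inter> ?L t \<noteq> {}}"]
        card_mono[of G "{b \<in> G. b \<inter> ?R t \<noteq> {}}"] by auto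
    define S where "S = root ?n (?m (\<Union>F)) + root ?n (?m (\<Union>G))"
    have S: "0 \<le> S" by (simp add: S_def)
    \<comment> \<open>Since both families are cut in the same ratio, \<open>root ?n \<tau>\<close>
      factors out of the induction hypothesis. The two halves then contribute the fractions
      \<open>\<theta>\<close> and \<open>1 - \<theta>\<close> of the same number
      \<open>S ^ ?n\<close>.\<close>
    have half: "\<tau> * S ^ ?n \<le> ?m (\<Union>F' + \<Union>G')"
      if "root ?n (?m (\<Union>F')) + root ?n (?m (\<Union>G')) \<le> root ?n (?m (\<Union>F' + \<Union>G'))"
        "?m (\<Union>F') = \<tau> * ?m (\<Union>F)" "?m (\<Union>G') = \<tau> * ?m (\<Union>G)" "0 < \<tau>" for F' G' \<tau>
    proof -
      have "root ?n \<tau> * S \<le> root ?n (?m (\<Union>F' + \<Union>G'))"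
        using that by (simp add: S_def real_root_mult algebra_simps)
      then have "(root ?n \<tau> * S) ^ ?n \<le> root ?n (?m (\<Union>F' + \<Union>G')) ^ ?n"
        using S that(4) by (intro power_mono) auto
      then show ?thesis using that(4) by (simp add: power_mult_distrib real_root_pow_pos2)
    qed
    have h1: "\<theta> * S ^ ?n \<le> ?m (\<Union>F1 + \<Union>G1)"
      using cF cG F1 G1 \<theta> t by (intro half IH) auto
    have h2: "(1 - \<theta>) * S ^ ?n \<le> ?m (\<Union>F2 + \<Union>G2)"
      using cF cG F2 G2 \<theta> t by (intro half IH) auto
    have oFG: "open (\<Union>F + \<Union>G)" "bounded (\<Union>F + \<Union>G)"
      using oF oG by (auto intro!: open_set_plus bounded_set_plus)
    \<comment> \<open>The cutting levels \<open>s\<close> and \<open>t\<close> add up, so the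
      hyperplane at level \<open>s + t\<close> separates the two sums.\<close>
    have sub: "\<Union>F1 + \<Union>G1 \<subseteq> (\<Union>F + \<Union>G) \<inter> ?L (s + t)" "\<Union>F2 + \<Union>G2 \<subseteq> (\<Union>F + \<Union>G) \<inter> ?R (s + t)"
      unfolding F1 F2 G1 G2 by (force simp: set_plus_def inner_add_left)+
    have o1: "open (\<Union>F1 + \<Union>G1)" "open (\<Union>F2 + \<Union>G2)"
      using box_family_Union F1(1) F2(1) by (auto intro!: open_set_plus)
    have oH: "open ((\<Union>F + \<Union>G) \<inter> ?L (s + t))" "open ((\<Union>F + \<Union>G) \<inter> ?R (s + t))"
      using oFG by (auto intro!: open_Int open_halfspace_component_lt open_halfspace_component_gt)
    have "S ^ ?n = \<theta> * S ^ ?n + (1 - \<theta>) * S ^ ?n" by (simp add: algebra_simps)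
    also have "\<dots> \<le> ?m (\<Union>F1 + \<Union>G1) + ?m (\<Union>F2 + \<Union>G2)" using h1 h2 by simp
    also have "\<dots> \<le> ?m ((\<Union>F + \<Union>G) \<inter> ?L (s + t)) + ?m ((\<Union>F + \<Union>G) \<inter> ?R (s + t))"
      using sub o1 oH oFG
      by (intro add_mono measure_mono_fmeasurable lmeasurable_open bounded_Int) (auto intro: lmeasurable_open)
    also have "\<dots> = ?m (\<Union>F + \<Union>G)"
      by (rule measure_halfspace_split[OF oFG k, symmetric])
    finally have "root ?n (S ^ ?n) \<le> root ?n (?m (\<Union>F + \<Union>G))" by simp
    then show ?thesis using S by (simp add: real_root_power_cancel) (simp add: S_def)
  qed
  have pos: "0 < card F" "0 < card G"
    using less.prems by (auto simp: box_family_def card_gt_0_iff)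
  consider "2 \<le> card F" | "2 \<le> card G" | "card F = 1" "card G = 1"
    using pos by linarith
  then show ?case
  proof cases
    case 1
    show ?thesis by (rule step[OF less.prems 1 less.hyps])
  next
    case 2
    have "root ?n (?m (\<Union>G)) + root ?n (?m (\<Union>F)) \<le> root ?n (?m (\<Union>G + \<Union>F))"
      by (rule step[OF less.prems(2,1) 2 less.hyps]) (simp add: add.commute)
    then show ?thesis by (simp add: add.commute)
  next
    case 3
    then obtain P Q where FG: "F = {P}" "G = {Q}" by (metis card_1_singletonE)
    have "\<exists>a b. P = box a b" "\<exists>a b. Q = box a b" "P \<noteq> {}" "Q \<noteq> {}"
      using less.prems FG by (auto simp: box_family_def)
    then obtain a b c d where ab: "P = box a b" "Q = box c d" and "P \<noteq> {}" "Q \<noteq> {}" by metis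
    then show ?thesis unfolding FG ab using brunn_minkowski_box[of a b c d] by simp
  qed
qed

section \<open>From boxes to open sets and convex bodies\<close>

text \<open>The covering lemma fills \<open>U\<close> with countably many boxes with disjoint
  interiors. Passing to interiors loses only null sets, and finite initial parts of an enumeration
  exhaust the volume.\<close>

lemma open_inner_box_families:
  fixes U :: "'a::euclidean_space set"
  assumes U: "open U" "bounded U" "U \<noteq> {}"
  obtains F where "\<And>i::nat. box_family (F i)" "\<And>i. \<Union>(F i) \<subseteq> U"
    "(\<lambda>i. measure lebesgue (\<Union>(F i))) \<longlonglongrightarrow> measure lebesgue U"
proof -
  obtain w where w: "U \<subseteq> cbox (-w) w" using bounded_subset_cbox_symmetric[OF U(2)] by metis
  have bne: "box (-w) w \<noteq> {}"
  proof -
    have "interior U \<subseteq> box (-w) w" using interior_mono[OF w] by (simp add: interior_cbox)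
    then show ?thesis using U by (auto simp: interior_open)
  qed
  \<comment> \<open>Every box of the cover lies in \<open>g x\<close> for some \<open>x\<close> in
    \<open>U\<close>, hence in \<open>U\<close> itself. The value \<open>UNIV\<close> elsewhere just
    makes \<open>g\<close> a gauge.\<close>
  define g where "g = (\<lambda>x. if x \<in> U then U else UNIV)"
  have "gauge g" using U by (auto simp: gauge_def g_def)
  obtain D where D: "countable D" "\<And>K. K \<in> D \<Longrightarrow> interior K \<noteq> {} \<and> (\<exists>c d. K = cbox c d)"
    "pairwise (\<lambda>A B. interior A \<inter> interior B = {}) D"
    "\<And>K. K \<in> D \<Longrightarrow> \<exists>x \<in> U \<inter> K. K \<subseteq> g x" "U \<subseteq> \<Union>D"
    by (rule covering_lemma[OF w bne \<open>gauge g\<close>]) blast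
  have DU: "K \<subseteq> U" if "K \<in> D" for K using D(4)[OF that] by (auto simp: g_def)
  have "D \<noteq> {}" using D(5) U by auto
  define E where "E = interior ` D"
  have E: "countable E" "E \<noteq> {}" using D(1) \<open>D \<noteq> {}\<close> by (auto simp: E_def)
  \<comment> \<open>If \<open>E\<close> is finite the enumeration repeats members, which is harmless
    because \<open>F i\<close> is a set.\<close>
  define F where "F = (\<lambda>i::nat. from_nat_into E ` {..i})"
  have FE: "F i \<subseteq> E" for i using from_nat_into[OF E(2)] by (auto simp: F_def)
  have fam: "box_family (F i)" for i
    unfolding box_family_def
  proof (intro conjI)
    show "finite (F i)" "F i \<noteq> {}" by (auto simp: F_def)
    have "pairwise disjnt E"
      unfolding E_def
    proof (rule pairwise_imageI)
      fix A B assume "A \<in> D" "B \<in> D" "A \<noteq> B"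
      then show "disjnt (interior A) (interior B)"
        using pairwiseD[OF D(3)] by (simp add: disjnt_def)
    qed
    then show "pairwise disjnt (F i)" by (rule pairwise_subset[OF _ FE])
    show "\<forall>b\<in>F i. b \<noteq> {} \<and> (\<exists>l u. b = box l u)"
    proof
      fix b assume "b \<in> F i"
      then obtain K where K: "K \<in> D" "b = interior K" using FE[of i] by (auto simp: E_def)
      obtain c d where "K = cbox c d" using D(2)[OF K(1)] by blast
      then show "b \<noteq> {} \<and> (\<exists>l u. b = box l u)"
        using D(2)[OF K(1)] K(2) interior_cbox[of c d] by blast
    qed
  qed
  have EU: "\<Union>E \<subseteq> U" using DU interior_subset by (fastforce simp: E_def)
  have UN: "(\<Union>i. \<Union>(F i)) = \<Union>E"
  proof -
    have "(\<Union>i. F i) = range (from_nat_into E)" by (auto simp: F_def)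
    then have "(\<Union>i. F i) = E" using E by (simp add: range_from_nat_into)
    then show ?thesis by blast
  qed
  have null: "negligible (\<Union>K\<in>D. K - interior K)"
  proof (rule negligible_countable_Union)
    show "countable ((\<lambda>K. K - interior K) ` D)" using D(1) by simp
    fix S assume "S \<in> (\<lambda>K. K - interior K) ` D"
    then obtain K where K: "K \<in> D" "S = K - interior K" by blast
    obtain c d where "K = cbox c d" using D(2)[OF K(1)] by blast
    then have "S = cbox c d - box c d" using K(2) by (simp add: interior_cbox)
    then show "negligible S" by (simp add: negligible_frontier_interval)
  qed
  have mE: "measure lebesgue (\<Union>E) = measure lebesgue U"
  proof (rule measure_negligible_symdiff)
    show "U \<in> lmeasurable" using U by (simp add: lmeasurable_open)
    have "U - \<Union>E \<union> (\<Union>E - U) \<subseteq> (\<Union>K\<in>D. K - interior K)"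
      using EU D(5) by (fastforce simp: E_def)
    then show "negligible (U - \<Union>E \<union> (\<Union>E - U))" using null negligible_subset by blast
  qed
  have sub: "\<Union>(F i) \<subseteq> U" for i using FE EU by blast
  have "(\<lambda>i. measure lebesgue (\<Union>(F i))) \<longlonglongrightarrow> measure lebesgue (\<Union>i. \<Union>(F i))"
  proof (rule Lim_measure_incseq)
    show "range (\<lambda>i. \<Union>(F i)) \<subseteq> sets lebesgue"
      using box_family_Union(1)[OF fam] by (auto intro: borel_open)
    show "incseq (\<lambda>i. \<Union>(F i))" unfolding incseq_def F_def by (auto intro: order_trans)
    have "\<Union>E \<in> lmeasurable"
      using U EU by (intro lmeasurable_open bounded_subset[OF U(2) EU]) (auto simp: E_def)
    then show "emeasure lebesgue (\<Union>i. \<Union>(F i)) \<noteq> \<infinity>"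
      unfolding UN using fmeasurableD2[of "\<Union>E" lebesgue] by (simp del: emeasure_completion)
  qed
  then show ?thesis using that[of F] fam sub by (simp add: UN mE)
qed

text \<open>Inner approximation suffices: sums of families inside \<open>U\<close> and
  \<open>V\<close> stay inside \<open>U + V\<close>, so the right-hand side bounds every approximant
  while the left-hand side converges.\<close>

lemma brunn_minkowski_open:
  fixes U V :: "'a::euclidean_space set"
  assumes U: "open U" "bounded U" "U \<noteq> {}" and V: "open V" "bounded V" "V \<noteq> {}"
  shows "root DIM('a) (measure lebesgue U) + root DIM('a) (measure lebesgue V) \<le>
    root DIM('a) (measure lebesgue (U + V))"
proof -
  obtain F where F: "\<And>i::nat. box_family (F i)" "\<And>i. \<Union>(F i) \<subseteq> U"
    "(\<lambda>i. measure lebesgue (\<Union>(F i))) \<longlonglongrightarrow> measure lebesgue U"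
    using open_inner_box_families[OF U] by metis
  obtain G where G: "\<And>i::nat. box_family (G i)" "\<And>i. \<Union>(G i) \<subseteq> V"
    "(\<lambda>i. measure lebesgue (\<Union>(G i))) \<longlonglongrightarrow> measure lebesgue V"
    using open_inner_box_families[OF V] by metis
  show ?thesis
  proof (rule LIMSEQ_le_const2)
    show "(\<lambda>i. root DIM('a) (measure lebesgue (\<Union>(F i))) + root DIM('a) (measure lebesgue (\<Union>(G i)))) \<longlonglongrightarrow>
        root DIM('a) (measure lebesgue U) + root DIM('a) (measure lebesgue V)"
      by (intro tendsto_add tendsto_real_root F G)
    have "root DIM('a) (measure lebesgue (\<Union>(F i))) + root DIM('a) (measure lebesgue (\<Union>(G i))) \<le>
        root DIM('a) (measure lebesgue (U + V))" for i
    proof -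
      have "root DIM('a) (measure lebesgue (\<Union>(F i))) + root DIM('a) (measure lebesgue (\<Union>(G i))) \<le>
          root DIM('a) (measure lebesgue (\<Union>(F i) + \<Union>(G i)))"
        by (rule brunn_minkowski_box_family[OF F(1) G(1)])
      also have "\<dots> \<le> root DIM('a) (measure lebesgue (U + V))"
        using U V box_family_Union[OF F(1)[of i]] set_plus_mono2[OF F(2)[of i] G(2)[of i]]
        by (intro iffD2[OF real_root_le_iff] measure_mono_fmeasurable lmeasurable_open)
          (auto intro!: open_set_plus bounded_set_plus borel_open)
      finally show ?thesis .
    qed
    then show "\<exists>N. \<forall>n\<ge>N. root DIM('a) (measure lebesgue (\<Union>(F n))) + root DIM('a) (measure lebesgue (\<Union>(G n))) \<le>
        root DIM('a) (measure lebesgue (U + V))" by blast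
  qed
qed

text \<open>The boundary of a bounded convex set is null, so the open case for the interiors carries
  the full volumes.\<close>

theorem brunn_minkowski_convex:
  fixes K L :: "'a::euclidean_space set"
  assumes K: "compact K" "convex K" "interior K \<noteq> {}" and L: "compact L" "convex L" "interior L \<noteq> {}"
  shows "root DIM('a) (measure lebesgue K) + root DIM('a) (measure lebesgue L) \<le>
    root DIM('a) (measure lebesgue (K + L))"
proof -
  have int: "measure lebesgue (interior S) = measure lebesgue S" if "compact S" "convex S" for S :: "'a set"
    using that by (intro measure_interior compact_imp_bounded negligible_convex_frontier)
  have "root DIM('a) (measure lebesgue K) + root DIM('a) (measure lebesgue L) \<le>
      root DIM('a) (measure lebesgue (interior K + interior L))"
    using brunn_minkowski_open[of "interior K" "interior L"] K L
    by (simp add: int compact_imp_bounded bounded_interior del: measure_completion)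
  also have "\<dots> \<le> root DIM('a) (measure lebesgue (K + L))"
  proof -
    have "K + L = (\<Union>x\<in>K. \<Union>y\<in>L. {x + y})" by (auto simp: set_plus_def)
    then have "K + L \<in> lmeasurable" using compact_sums'[OF K(1) L(1)] by (simp add: lmeasurable_compact)
    then show ?thesis
      by (intro iffD2[OF real_root_le_iff] measure_mono_fmeasurable set_plus_mono2 interior_subset)
        (auto intro!: open_set_plus borel_open sets_completionI_sets)
  qed
  finally show ?thesis .
qed

subsection \<open>Zonoids\<close>

lemma
  fixes y :: "nat \<Rightarrow> 'a::euclidean_space"
  shows compact_segments: "compact (\<Sum>i<k. closed_segment 0 (y i))"
    and convex_segments: "convex (\<Sum>i<k. closed_segment 0 (y i))"
    and zero_in_segments: "0 \<in> (\<Sum>i<k. closed_segment 0 (y i))"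
proof -
  show "compact (\<Sum>i<k. closed_segment 0 (y i))"
    by (induction k) (auto intro: compact_set_plus simp: set_zero)
  show "convex (\<Sum>i<k. closed_segment 0 (y i))"
    by (intro convex_set_sum) auto
  show "0 \<in> (\<Sum>i<k. closed_segment 0 (y i))"
  proof (induction k)
    case (Suc k)
    have "0 + 0 \<in> (\<Sum>i<k. closed_segment 0 (y i)) + closed_segment 0 (y k)"
      by (intro set_plus_intro Suc) auto
    then show ?case by simp
  qed (simp add: set_zero)
qed

lemma subset_set_plus_right: "0 \<in> B \<Longrightarrow> A \<subseteq> A + (B :: 'a::monoid_add set)"
  using set_plus_intro[of _ A 0 B] by force

text \<open>The zero vector gets an arbitrary direction, so that degenerate segments need no
  separate treatment.\<close>

lemma unit_direction:
  fixes y :: "'a::euclidean_space"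
  obtains \<xi> where "norm \<xi> = 1" "y = norm y *\<^sub>R \<xi>"
proof (cases "y = 0")
  case True
  obtain \<xi> :: 'a where "norm \<xi> = 1" using vector_choose_size[of 1] by auto
  then show ?thesis using True that by simp
next
  case False
  then show ?thesis by (intro that[of "y /\<^sub>R norm y"]) auto
qed

text \<open>The intermediate sums contain \<open>K\<close>, so their projections are at least those
  of \<open>K\<close>, and the k-th segment adds at least \<open>m * norm (y k)\<close>.\<close>

lemma measure_add_segments_ge:
  fixes K :: "'a::euclidean_space set" and y :: "nat \<Rightarrow> 'a"
  assumes K: "compact K" "convex K" and m: "\<And>\<xi>. norm \<xi> = 1 \<Longrightarrow> m \<le> perp_proj_vol \<xi> K"
  shows "measure lebesgue K + m * (\<Sum>i<k. norm (y i)) \<le>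
    measure lebesgue (K + (\<Sum>i<k. closed_segment 0 (y i)))"
proof (induction k)
  case (Suc k)
  let ?S = "K + (\<Sum>i<k. closed_segment 0 (y i))"
  obtain \<xi> where \<xi>: "norm \<xi> = 1" "y k = norm (y k) *\<^sub>R \<xi>" by (rule unit_direction)
  have S: "compact ?S" "convex ?S" "K \<subseteq> ?S"
    by (intro compact_set_plus convex_set_plus K compact_segments convex_segments
        subset_set_plus_right zero_in_segments)+
  have "measure lebesgue (K + (\<Sum>i<Suc k. closed_segment 0 (y i))) =
      measure lebesgue (?S + closed_segment 0 (norm (y k) *\<^sub>R \<xi>))"
    using \<xi>(2) by (simp add: add.assoc)
  also have "\<dots> = measure lebesgue ?S + norm (y k) * perp_proj_vol \<xi> ?S"
    by (intro measure_lebesgue_add_segment S \<xi>) simp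
  also have "\<dots> \<ge> measure lebesgue ?S + norm (y k) * m"
    using m[OF \<xi>(1)] perp_proj_vol_mono[OF \<xi>(1) K(1) S(1,3)]
    by (intro add_left_mono mult_left_mono) auto
  finally show ?case using Suc.IH by (simp add: algebra_simps)
qed (simp add: set_zero)

text \<open>Counterpart of the lower bound: all intermediate sums lie in the one body
  \<open>L\<close>, whose projections bound every increment.\<close>

lemma measure_add_segments_le:
  fixes K L :: "'a::euclidean_space set" and y :: "nat \<Rightarrow> 'a"
  assumes K: "compact K" "convex K" and L: "compact L"
    and sub: "K + (\<Sum>i<k. closed_segment 0 (y i)) \<subseteq> L"
    and M: "\<And>\<xi>. norm \<xi> = 1 \<Longrightarrow> perp_proj_vol \<xi> L \<le> M"
  shows "measure lebesgue (K + (\<Sum>i<k. closed_segment 0 (y i))) \<le>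
    measure lebesgue K + M * (\<Sum>i<k. norm (y i))"
  using sub
proof (induction k)
  case (Suc k)
  let ?S = "K + (\<Sum>i<k. closed_segment 0 (y i))"
  obtain \<xi> where \<xi>: "norm \<xi> = 1" "y k = norm (y k) *\<^sub>R \<xi>" by (rule unit_direction)
  have S: "compact ?S" "convex ?S"
    by (intro compact_set_plus convex_set_plus K compact_segments convex_segments)+
  have eq: "K + (\<Sum>i<Suc k. closed_segment 0 (y i)) = ?S + closed_segment 0 (norm (y k) *\<^sub>R \<xi>)"
    using \<xi>(2) by (simp add: add.assoc)
  have SL: "?S \<subseteq> L"
    using Suc.prems subset_set_plus_right[of "closed_segment 0 (norm (y k) *\<^sub>R \<xi>)" ?S]
    unfolding eq by auto
  have "measure lebesgue (?S + closed_segment 0 (norm (y k) *\<^sub>R \<xi>)) =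
      measure lebesgue ?S + norm (y k) * perp_proj_vol \<xi> ?S"
    by (intro measure_lebesgue_add_segment S \<xi>) simp
  also have "\<dots> \<le> measure lebesgue ?S + norm (y k) * M"
    using M[OF \<xi>(1)] perp_proj_vol_mono[OF \<xi>(1) S(1) L SL]
    by (intro add_left_mono mult_left_mono) auto
  finally show ?case unfolding eq using Suc.IH[OF SL] by (simp add: algebra_simps)
qed (simp add: set_zero)

lemma segments_scaled:
  fixes y :: "nat \<Rightarrow> 'a::euclidean_space"
  shows "(\<Sum>i<k. closed_segment 0 (c *\<^sub>R y i)) = (*\<^sub>R) c ` (\<Sum>i<k. closed_segment 0 (y i))"
proof (induction k)
  case (Suc k)
  have "closed_segment 0 (c *\<^sub>R y k) = (*\<^sub>R) c ` closed_segment 0 (y k)"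
    using closed_segment_linear_image[of "(*\<^sub>R) c" 0 "y k"] by (simp add: linear_scaleR)
  moreover have "(*\<^sub>R) c ` (S + T) = (*\<^sub>R) c ` S + (*\<^sub>R) c ` T" for S T :: "'a set"
  proof (intro equalityI subsetI)
    show "x \<in> (*\<^sub>R) c ` S + (*\<^sub>R) c ` T" if "x \<in> (*\<^sub>R) c ` (S + T)" for x
      using that by (auto elim!: set_plus_elim intro!: set_plus_intro simp: scaleR_add_right)
    show "x \<in> (*\<^sub>R) c ` (S + T)" if "x \<in> (*\<^sub>R) c ` S + (*\<^sub>R) c ` T" for x
      using that by (auto elim!: set_plus_elim simp: scaleR_add_right[symmetric])
  qed
  ultimately show ?case using Suc by simp
qed (simp add: set_zero)

text \<open>Collects the positions of the segments into a single translation, which does not affect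
  volumes.\<close>

lemma segments_translated:
  fixes u v :: "nat \<Rightarrow> 'a::euclidean_space"
  shows "(\<Sum>i<k. closed_segment (u i) (v i)) = {\<Sum>i<k. u i} + (\<Sum>i<k. closed_segment 0 (v i - u i))"
proof (induction k)
  case (Suc k)
  have "closed_segment (u k) (v k) = {u k} + closed_segment 0 (v k - u k)"
    using closed_segment_translation[of "u k" 0 "v k - u k"] by (auto simp: set_plus_image)
  then have "(\<Sum>i<Suc k. closed_segment (u i) (v i)) =
      ({\<Sum>i<k. u i} + (\<Sum>i<k. closed_segment 0 (v i - u i))) + ({u k} + closed_segment 0 (v k - u k))"
    using Suc by simp
  also have "\<dots> = ({\<Sum>i<k. u i} + {u k}) + (\<Sum>i<Suc k. closed_segment 0 (v i - u i))"
    by (simp add: ac_simps)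
  also have "{\<Sum>i<k. u i} + {u k} = {\<Sum>i<Suc k. u i}"
    by (simp add: set_plus_def)
  finally show ?case .
qed (simp add: set_zero)

section \<open>Approximation errors and their absorption\<close>

text \<open>Each of the two suprema in \<open>hausdorff_dist\<close> serves one estimate: the first
  closeness property bounds the total length from above, the second gives Urysohn's
  inequality.\<close>

lemma zonoid_approx:
  fixes Z :: "'a::euclidean_space set"
  assumes Z: "zonoid Z" and d: "0 < d"
  obtains k y w where
    "\<And>a. a \<in> (\<Sum>i<(k::nat). closed_segment 0 (y i)) \<Longrightarrow> \<exists>z\<in>Z. norm (w + a - z) \<le> d"
    "\<And>z. z \<in> Z \<Longrightarrow> \<exists>a\<in>(\<Sum>i<k. closed_segment 0 (y i)). norm (z - (w + a)) \<le> d"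
proof -
  obtain A where A: "\<And>k. segment_sum (A k)" "(\<lambda>k. hausdorff_dist (A k) Z) \<longlonglongrightarrow> 0"
    using Z by (auto simp: zonoid_def)
  have cZ: "compact Z" "Z \<noteq> {}" using Z by (auto simp: zonoid_def convex_body_def)
  obtain j where j: "hausdorff_dist (A j) Z < d"
    using order_tendstoD(2)[OF A(2) d] by (auto simp: eventually_sequentially)
  obtain k u v where Aj: "A j = (\<Sum>i<(k::nat). closed_segment (u i) (v i))"
    using A(1)[of j] by (auto simp: segment_sum_def)
  let ?S = "\<Sum>i<k. closed_segment 0 (v i - u i)" and ?w = "\<Sum>i<k. u i"
  have AS: "A j = {?w} + ?S" unfolding Aj by (rule segments_translated)
  have cA: "compact (A j)" "A j \<noteq> {}"
  proof -
    show "compact (A j)" unfolding AS by (intro compact_set_plus compact_segments) simp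
    have "?w + 0 \<in> {?w} + ?S" by (intro set_plus_intro zero_in_segments) simp
    then show "A j \<noteq> {}" unfolding AS by blast
  qed
  \<comment> \<open>A real \<open>SUP\<close> dominates its members only when they are bounded
    above; compactness ensures this.\<close>
  have bdd: "bdd_above ((\<lambda>a. infdist a C) ` B)" if "compact B" for B C :: "'a set"
    using that by (intro bounded_imp_bdd_above compact_imp_bounded compact_continuous_image continuous_intros)
  have near: "\<exists>c\<in>C. norm (b - c) \<le> d"
    if B: "compact C" "C \<noteq> {}" "compact B" "(SUP b\<in>B. infdist b C) < d" "b \<in> B" for B C :: "'a set" and b
  proof -
    obtain c where "c \<in> C" "infdist b C = dist b c"
      using infdist_attains_inf[of C b] B(1,2) compact_imp_closed by metis
    moreover have "infdist b C \<le> (SUP b\<in>B. infdist b C)"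
      by (intro cSUP_upper bdd B)
    ultimately show ?thesis using B(4) by (auto simp: dist_norm intro!: bexI[of _ c])
  qed
  have sup: "(SUP a\<in>A j. infdist a Z) < d" "(SUP z\<in>Z. infdist z (A j)) < d"
    using j by (auto simp: hausdorff_dist_def)
  show ?thesis
  proof (rule that[of "\<lambda>i. v i - u i" k ?w])
    show "\<exists>z\<in>Z. norm (?w + a - z) \<le> d" if "a \<in> ?S" for a
      using near[OF cZ cA(1) sup(1), of "?w + a"] that by (auto simp: AS)
    show "\<exists>a\<in>?S. norm (z - (?w + a)) \<le> d" if "z \<in> Z" for z
      using near[OF cA cZ(1) sup(2) that] by (auto simp: AS set_plus_def)
  qed
qed

text \<open>By symmetry an interior ball around \<open>x\<close> has a mirror image around
  \<open>- x\<close>; averaging \<open>x + y\<close> with \<open>- (x - y)\<close> centres the ball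
  at the origin.\<close>

lemma zonoid_contains_ball:
  fixes Z :: "'a::euclidean_space set"
  assumes Z: "zonoid Z"
  obtains r where "0 < r" "cball 0 r \<subseteq> Z"
proof -
  have Z': "convex Z" "interior Z \<noteq> {}" "uminus ` Z = Z"
    using Z by (auto simp: zonoid_def convex_body_def)
  then obtain x e where x: "0 < e" "cball x e \<subseteq> Z"
    using mem_interior_cball by (metis all_not_in_conv)
  have "cball 0 e \<subseteq> Z"
  proof
    fix y assume y: "y \<in> cball (0::'a) e"
    have "x + y \<in> Z" "x - y \<in> Z" using y x(2) by (auto simp: dist_norm subset_iff)
    then have "- (x - y) \<in> Z" using Z'(3) by blast
    then have "(1/2) *\<^sub>R (x + y) + (1/2) *\<^sub>R (- (x - y)) \<in> Z"
      using \<open>x + y \<in> Z\<close> Z'(1) by (intro convexD) auto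
    moreover have "(1/2) *\<^sub>R (x + y) + (1/2) *\<^sub>R (- (x - y)) = y"
      by (simp add: scaleR_add_right[symmetric] scaleR_2[symmetric])
    ultimately show "y \<in> Z" by simp
  qed
  then show ?thesis using that x(1) by blast
qed

text \<open>The ball of radius \<open>s\<close> is contained in \<open>(s / r) W\<close>, and
  \<open>W + (s / r) W = (1 + s / r) W\<close> by convexity. This turns additive errors into
  dilations, whose effect on volume is explicit.\<close>

lemma convex_absorb:
  fixes W :: "'a::real_normed_vector set"
  assumes W: "convex W" "cball 0 r \<subseteq> W" "0 < r" and x: "x \<in> W" and v: "norm v \<le> s"
  shows "x + v \<in> (*\<^sub>R) (1 + s / r) ` W"
proof (cases "s = 0")
  case True
  then show ?thesis using x v by (auto simp: image_iff)
next
  case False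
  then have s: "0 < s" using v norm_ge_zero[of v] by linarith
  have "(r / s) *\<^sub>R v \<in> cball 0 r"
    using v s W(3) by (simp add: field_simps)
  then have q: "(r / s) *\<^sub>R v \<in> W" using W(2) by blast
  define c where "c = 1 + s / r"
  have c: "0 < c" using s W(3) by (simp add: c_def add_pos_pos)
  have c1: "1 / c + (s / r) / c = 1"
    using c unfolding c_def add_divide_distrib[symmetric] by simp
  have "(1 / c) *\<^sub>R x + ((s / r) / c) *\<^sub>R ((r / s) *\<^sub>R v) \<in> W"
    using c c1 s W(3) by (intro convexD[OF W(1)] x q) auto
  moreover have "x + v = c *\<^sub>R ((1 / c) *\<^sub>R x + ((s / r) / c) *\<^sub>R ((r / s) *\<^sub>R v))"
    using c s W(3) by (simp add: scaleR_add_right)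
  ultimately show ?thesis unfolding c_def by blast
qed

lemma measure_lebesgue_scaleR:
  fixes S :: "'a::euclidean_space set"
  shows "0 \<le> c \<Longrightarrow> measure lebesgue ((*\<^sub>R) c ` S) = c ^ DIM('a) * measure lebesgue S"
  using measure_lebesgue_affine[of c 0 S] by simp

lemma measure_mono_compact:
  fixes S T :: "'a::euclidean_space set"
  shows "compact S \<Longrightarrow> compact T \<Longrightarrow> S \<subseteq> T \<Longrightarrow> measure lebesgue S \<le> measure lebesgue T"
  by (intro measure_mono_fmeasurable) (auto intro: lmeasurable_compact fmeasurableD)

text \<open>The hyperplanes carry measures built from arbitrarily chosen bases, so continuity in
  \<open>\<xi>\<close> is not visible directly. Adding a unit segment expresses the projection
  volume as \<open>h \<xi>\<close> minus the volume of \<open>Z\<close>, and \<open>h\<close> uses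
  only the volume of the ambient space.\<close>

lemma perp_proj_vol_attains_min:
  fixes Z :: "'a::euclidean_space set"
  assumes Z: "compact Z" "convex Z" "0 < r" "cball 0 r \<subseteq> Z"
  obtains \<xi> where "norm \<xi> = 1" "\<And>\<eta>. norm \<eta> = 1 \<Longrightarrow> perp_proj_vol \<xi> Z \<le> perp_proj_vol \<eta> Z"
proof -
  let ?n = "DIM('a)"
  define h where "h = (\<lambda>y. measure lebesgue (Z + closed_segment 0 y))"
  \<comment> \<open>Exchanging \<open>y\<close> and \<open>y'\<close> bounds \<open>h y'\<close>
    from both sides, and the factor tends to 1 as \<open>y'\<close> approaches
    \<open>y\<close>.\<close>
  have h_le: "h y' \<le> (1 + dist y' y / r) ^ ?n * h y" for y y'
  proof -
    let ?W = "Z + closed_segment 0 y"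
    have cW: "compact (Z + closed_segment 0 u)" "convex (Z + closed_segment 0 u)"
      "Z \<subseteq> Z + closed_segment 0 u" for u
      using Z by (auto intro!: compact_set_plus convex_set_plus subset_set_plus_right)
    have "Z + closed_segment 0 y' \<subseteq> (*\<^sub>R) (1 + dist y' y / r) ` ?W"
    proof
      fix x assume "x \<in> Z + closed_segment 0 y'"
      then obtain z t where z: "z \<in> Z" and t: "0 \<le> t" "t \<le> 1" and x: "x = z + t *\<^sub>R y'"
        by (auto simp: set_plus_def closed_segment_def)
      have "z + t *\<^sub>R y \<in> ?W" using z t by (auto simp: closed_segment_def)
      moreover have "norm (t *\<^sub>R (y' - y)) \<le> dist y' y"
        using t by (simp add: dist_norm mult_left_le_one_le)
      ultimately have "(z + t *\<^sub>R y) + t *\<^sub>R (y' - y) \<in> (*\<^sub>R) (1 + dist y' y / r) ` ?W"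
        by (intro convex_absorb cW Z(3) order_trans[OF Z(4) cW(3)])
      then show "x \<in> (*\<^sub>R) (1 + dist y' y / r) ` ?W" by (simp add: x algebra_simps)
    qed
    then have "h y' \<le> measure lebesgue ((*\<^sub>R) (1 + dist y' y / r) ` ?W)"
      unfolding h_def using cW by (intro measure_mono_compact compact_scaling) auto
    also have "\<dots> = (1 + dist y' y / r) ^ ?n * h y"
      unfolding h_def using Z(3) by (intro measure_lebesgue_scaleR) simp
    finally show ?thesis .
  qed
  have cont: "(h \<longlongrightarrow> h y) (at y within S)" for y S
  proof (rule real_tendsto_sandwich)
    have pos: "0 < (1 + dist y' y / r) ^ ?n" for y'
      using Z(3) by (intro zero_less_power add_pos_nonneg) auto
    show "\<forall>\<^sub>F y' in at y within S. h y / (1 + dist y' y / r) ^ ?n \<le> h y'"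
      using h_le[of y] pos by (intro always_eventually) (simp add: pos_divide_le_eq mult.commute dist_commute)
    show "\<forall>\<^sub>F y' in at y within S. h y' \<le> (1 + dist y' y / r) ^ ?n * h y"
      using h_le by simp
    show "((\<lambda>y'. h y / (1 + dist y' y / r) ^ ?n) \<longlongrightarrow> h y) (at y within S)"
      using Z(3) by (auto intro!: tendsto_eq_intros)
    show "((\<lambda>y'. (1 + dist y' y / r) ^ ?n * h y) \<longlongrightarrow> h y) (at y within S)"
      using Z(3) by (auto intro!: tendsto_eq_intros)
  qed
  have h: "h \<xi> = measure lebesgue Z + perp_proj_vol \<xi> Z" if "norm \<xi> = 1" for \<xi>
    unfolding h_def using measure_lebesgue_add_segment[OF Z(1,2) that, of 1] by simp
  have "\<exists>x\<in>sphere (0::'a) 1. \<forall>y\<in>sphere 0 1. h x \<le> h y"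
    using cont by (intro continuous_attains_inf) (auto simp: continuous_on_def)
  then obtain \<xi> where "\<xi> \<in> sphere 0 1" "\<forall>y\<in>sphere 0 1. h \<xi> \<le> h y" by blast
  then show ?thesis using h by (intro that[of \<xi>]) auto
qed

section \<open>First-order comparison of volumes\<close>

lemma slope_le_derivative:
  fixes f :: "real \<Rightarrow> real"
  assumes f: "(f has_real_derivative D) (at 0)" and B: "\<And>e. 0 < e \<Longrightarrow> f 0 + e * B \<le> f e"
  shows "B \<le> D"
proof (rule tendsto_lowerbound)
  show "((\<lambda>e. (f e - f 0) / e) \<longlongrightarrow> D) (at_right 0)"
    using f unfolding has_field_derivative_iff by (simp add: filterlim_at_split)
  show "\<forall>\<^sub>F e in at_right 0. B \<le> (f e - f 0) / e"
    using eventually_at_right_less[of 0]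
    by eventually_elim (use B in \<open>simp add: pos_le_divide_eq algebra_simps le_diff_eq\<close>)
qed simp

text \<open>\<open>Z + e A\<close> fits into a translate of \<open>(1 + e c) Z\<close> with
  \<open>c = 1 + d / r\<close>, where \<open>d / r\<close> is the cost of \<open>A\<close> only
  approximating \<open>Z\<close>. Both sides of the volume inequality equal \<open>|Z|\<close> at
  \<open>e = 0\<close>, so their slopes can be compared.\<close>

lemma segment_length_upper:
  fixes Z :: "'a::euclidean_space set"
  assumes Z: "compact Z" "convex Z" "0 < r" "cball 0 r \<subseteq> Z" and d: "0 < d"
    and m: "\<And>\<xi>. norm \<xi> = 1 \<Longrightarrow> m \<le> perp_proj_vol \<xi> Z"
    and near: "\<And>a. a \<in> (\<Sum>i<(k::nat). closed_segment 0 (y i)) \<Longrightarrow> \<exists>z\<in>Z. norm (w + a - z) \<le> d"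
  shows "m * (\<Sum>i<k. norm (y i)) \<le> real DIM('a) * (1 + d / r) * measure lebesgue Z"
proof -
  let ?n = "DIM('a)" and ?V = "measure lebesgue Z" and ?L = "\<Sum>i<k. norm (y i)"
  define c where "c = 1 + d / r"
  have V: "?V + m * (e * ?L) \<le> (1 + e * c) ^ ?n * ?V" if e: "0 < e" for e
  proof -
    let ?S = "\<Sum>i<k. closed_segment 0 (e *\<^sub>R y i)"
    have "?V + m * (e * ?L) = ?V + m * (\<Sum>i<k. norm (e *\<^sub>R y i))"
      using e by (simp add: sum_distrib_left)
    also have "\<dots> \<le> measure lebesgue (Z + ?S)"
      by (intro measure_add_segments_ge Z m)
    also have "\<dots> \<le> measure lebesgue ((\<lambda>x. (1 + e * c) *\<^sub>R x + (- (e *\<^sub>R w))) ` Z)"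
    proof (intro measure_mono_compact)
      show "compact (Z + ?S)" by (intro compact_set_plus Z compact_segments)
      show "compact ((\<lambda>x. (1 + e * c) *\<^sub>R x + (- (e *\<^sub>R w))) ` Z)"
        by (intro compact_continuous_image Z continuous_intros)
      show "Z + ?S \<subseteq> (\<lambda>x. (1 + e * c) *\<^sub>R x + (- (e *\<^sub>R w))) ` Z"
      proof
        fix x assume "x \<in> Z + ?S"
        then obtain z a where z: "z \<in> Z" and a: "a \<in> (\<Sum>i<k. closed_segment 0 (y i))"
          and x: "x = z + e *\<^sub>R a"
          unfolding segments_scaled by (auto elim!: set_plus_elim)
        obtain z' where z': "z' \<in> Z" "norm (w + a - z') \<le> d" using near[OF a] by blast
        \<comment> \<open>\<open>x + e w\<close> is written as \<open>(1 + e) (p + q)\<close>, with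
          \<open>p\<close> a convex combination in \<open>Z\<close> and \<open>q\<close> the scaled
          error. Absorbing \<open>q\<close> gives the total factor
          \<open>(1 + e) (1 + e / (1 + e) * d / r) = 1 + e c\<close>.\<close>
        define p where "p = (1 / (1 + e)) *\<^sub>R z + (e / (1 + e)) *\<^sub>R z'"
        define q where "q = (e / (1 + e)) *\<^sub>R (w + a - z')"
        have "p \<in> Z" unfolding p_def
          using e by (intro convexD[OF Z(2)] z z') (simp_all add: add_divide_distrib[symmetric])
        moreover have "norm q \<le> (e / (1 + e)) * d"
          unfolding q_def using e z'(2) by (simp add: divide_right_mono mult_left_mono)
        ultimately have "p + q \<in> (*\<^sub>R) (1 + (e / (1 + e)) * d / r) ` Z"
          using Z by (intro convex_absorb)
        then obtain z'' where z'': "z'' \<in> Z" "p + q = (1 + (e / (1 + e)) * d / r) *\<^sub>R z''" by blast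
        have e1: "(1 + e) * (1 / (1 + e)) = 1" "(1 + e) * (e / (1 + e)) = e" using e by simp_all
        have "x + e *\<^sub>R w = (1 + e) *\<^sub>R (p + q)"
          unfolding p_def q_def x scaleR_add_right[of "1 + e"] scaleR_scaleR e1
          by (simp add: algebra_simps)
        also have "\<dots> = (1 + e * c) *\<^sub>R z''"
        proof -
          have dist: "(1 + e) * (1 + s * d / r) = (1 + e) + ((1 + e) * s) * (d / r)" for s
            by (simp add: algebra_simps add_divide_distrib)
          have "(1 + e) * (1 + (e / (1 + e)) * d / r) = 1 + e * c"
            unfolding dist e1 by (simp add: c_def algebra_simps)
          then show ?thesis by (simp add: z''(2))
        qed
        finally have "x = (1 + e * c) *\<^sub>R z'' + (- (e *\<^sub>R w))" by (simp add: algebra_simps)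
        then show "x \<in> (\<lambda>x. (1 + e * c) *\<^sub>R x + (- (e *\<^sub>R w))) ` Z" using z''(1) by blast
      qed
    qed
    also have "\<dots> = \<bar>1 + e * c\<bar> ^ ?n * ?V" by (rule measure_lebesgue_affine)
    also have "\<bar>1 + e * c\<bar> = 1 + e * c" using e Z(3) d by (simp add: c_def)
    finally show ?thesis .
  qed
  have "((\<lambda>e. (1 + e * c) ^ ?n * ?V) has_real_derivative (?n * c * ?V)) (at 0)"
    by (auto intro!: derivative_eq_intros)
  then have "m * ?L \<le> ?n * c * ?V"
    by (rule slope_le_derivative) (use V in \<open>simp add: mult.left_commute\<close>)
  then show ?thesis by (simp add: c_def)
qed

text \<open>Urysohn's inequality up to an error in \<open>d\<close>. With \<open>B\<close> the unit
  ball, \<open>B + e Z\<close> lies in a translate of \<open>(1 + e d) B + e A\<close>: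
  Brunn--Minkowski bounds the former from below, segment-wise growth the latter from above. The
  bounds agree at \<open>e = 0\<close>.\<close>

lemma segment_length_lower:
  fixes Z :: "'a::euclidean_space set"
  assumes Z: "compact Z" "convex Z" "interior Z \<noteq> {}" and d: "0 < d"
    and near: "\<And>z. z \<in> Z \<Longrightarrow> \<exists>a\<in>(\<Sum>i<(k::nat). closed_segment 0 (y i)). norm (z - (w + a)) \<le> d"
  defines "n \<equiv> DIM('a)"
  shows "real n * root n (unit_ball_vol n) ^ (n - 1) * root n (measure lebesgue Z) \<le>
    real n * d * unit_ball_vol n + unit_ball_vol (real (n - 1)) * (\<Sum>i<k. norm (y i))"
proof -
  let ?L = "\<Sum>i<k. norm (y i)" and ?\<omega> = "unit_ball_vol (real n)" and ?\<omega>' = "unit_ball_vol (real (n - 1))"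
  define p where "p = root n ?\<omega>"
  define q where "q = root n (measure lebesgue Z)"
  have n: "0 < n" by (simp add: n_def)
  have L: "0 \<le> ?L" by (simp add: sum_nonneg)
  have vol: "(p + e * q) ^ n \<le> (1 + e * d) ^ n * ?\<omega> + ?\<omega>' * (1 + e * d + e * ?L) ^ (n - 1) * (e * ?L)"
    if e: "0 < e" for e
  proof -
    let ?S = "\<Sum>i<k. closed_segment 0 (e *\<^sub>R y i)" and ?eZ = "(*\<^sub>R) e ` Z"
    let ?B = "cball (0::'a) (1 + e * d)" and ?B' = "cball (0::'a) (1 + e * d + e * ?L)"
    have eZ: "compact ?eZ" "convex ?eZ" "interior ?eZ \<noteq> {}"
    proof -
      show "compact ?eZ" "convex ?eZ" using Z by (auto intro: compact_scaling convex_scaling)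
      have "interior ?eZ = (*\<^sub>R) e ` interior Z"
        using e by (intro interior_injective_linear_image) (auto simp: linear_scaleR inj_on_def)
      then show "interior ?eZ \<noteq> {}" using Z by simp
    qed
    have r: "root n (measure lebesgue ?eZ) = e * q"
      using e n by (simp add: measure_lebesgue_scaleR n_def[symmetric] real_root_mult q_def
          real_root_power_cancel del: measure_completion)
    have "p + e * q \<le> root n (measure lebesgue (cball 0 1 + ?eZ))"
      using brunn_minkowski_convex[OF compact_cball convex_cball _ eZ, of "0::'a" 1]
      by (simp add: content_cball n_def[symmetric] r p_def)
    moreover have "0 \<le> p + e * q"
      unfolding p_def q_def using e
      by (intro add_nonneg_nonneg mult_nonneg_nonneg real_root_ge_zero unit_ball_vol_nonneg measure_nonneg) auto
    ultimately have "(p + e * q) ^ n \<le> root n (measure lebesgue (cball 0 1 + ?eZ)) ^ n"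
      by (intro power_mono)
    also have "\<dots> = measure lebesgue (cball 0 1 + ?eZ)"
      using n by (intro real_root_pow_pos2) auto
    also have "\<dots> \<le> measure lebesgue ((\<lambda>x. 1 *\<^sub>R x + e *\<^sub>R w) ` (?B + ?S))"
    proof (intro measure_mono_compact)
      show "compact (cball 0 1 + ?eZ)" by (intro compact_set_plus compact_cball eZ)
      show "compact ((\<lambda>x. 1 *\<^sub>R x + e *\<^sub>R w) ` (?B + ?S))"
        by (intro compact_continuous_image continuous_intros compact_set_plus compact_cball compact_segments)
      show "cball 0 1 + ?eZ \<subseteq> (\<lambda>x. 1 *\<^sub>R x + e *\<^sub>R w) ` (?B + ?S)"
      proof
        fix x assume "x \<in> cball 0 1 + ?eZ"
        then obtain b z where b: "norm b \<le> 1" and z: "z \<in> Z" and x: "x = b + e *\<^sub>R z"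
          by (auto elim!: set_plus_elim)
        obtain a where a: "a \<in> (\<Sum>i<k. closed_segment 0 (y i))" "norm (z - (w + a)) \<le> d"
          using near[OF z] by blast
        have "norm (b + e *\<^sub>R (z - (w + a))) \<le> 1 + e * d"
          using b a(2) e by (intro order_trans[OF norm_triangle_ineq] add_mono) (auto intro: mult_left_mono)
        then have "b + e *\<^sub>R (z - (w + a)) \<in> ?B" by simp
        moreover have "e *\<^sub>R a \<in> ?S" unfolding segments_scaled using a(1) by blast
        ultimately have "(b + e *\<^sub>R (z - (w + a))) + e *\<^sub>R a \<in> ?B + ?S" by (rule set_plus_intro)
        moreover have "x = 1 *\<^sub>R ((b + e *\<^sub>R (z - (w + a))) + e *\<^sub>R a) + e *\<^sub>R w"
          by (simp add: x algebra_simps)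
        ultimately show "x \<in> (\<lambda>x. 1 *\<^sub>R x + e *\<^sub>R w) ` (?B + ?S)" by blast
      qed
    qed
    also have "\<dots> = measure lebesgue (?B + ?S)"
      using measure_lebesgue_affine[of 1 "e *\<^sub>R w" "?B + ?S"] by simp
    also have "\<dots> \<le> measure lebesgue ?B + ?\<omega>' * (1 + e * d + e * ?L) ^ (n - 1) * (\<Sum>i<k. norm (e *\<^sub>R y i))"
    proof (rule measure_add_segments_le)
      have seg: "norm a \<le> (\<Sum>i<k. norm (z i))" if "a \<in> (\<Sum>i<k. closed_segment 0 (z i))"
        for a and z :: "nat \<Rightarrow> 'a" and k :: nat
        using that
      proof (induction k arbitrary: a)
        case (Suc k)
        then obtain b t where "b \<in> (\<Sum>i<k. closed_segment 0 (z i))" "0 \<le> t" "t \<le> 1" "a = b + t *\<^sub>R z k"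
          by (auto simp: closed_segment_def elim!: set_plus_elim)
        then show ?case using Suc.IH[of b] norm_triangle_ineq[of b "t *\<^sub>R z k"]
            mult_left_le_one_le[of "norm (z k)" t] by simp
      qed (simp add: set_zero)
      \<comment> \<open>All intermediate sums stay in this ball, whose projections are balls of the
        same radius. The excess of the radius over 1 vanishes with \<open>e\<close>.\<close>
      show "?B + ?S \<subseteq> ?B'"
      proof
        fix x assume "x \<in> ?B + ?S"
        then obtain b a where "norm b \<le> 1 + e * d" "a \<in> ?S" "x = b + a" by (auto elim!: set_plus_elim)
        then show "x \<in> ?B'"
          using seg[of a "\<lambda>i. e *\<^sub>R y i" k] norm_triangle_ineq[of b a] e by (simp add: sum_distrib_left)
      qed
      show "perp_proj_vol \<xi> ?B' \<le> ?\<omega>' * (1 + e * d + e * ?L) ^ (n - 1)" if "norm \<xi> = 1" for \<xi>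
        using perp_proj_vol_cball[OF that, of "1 + e * d + e * ?L"] e d L by (simp add: n_def add_pos_nonneg)
    qed auto
    also have "measure lebesgue ?B = (1 + e * d) ^ n * ?\<omega>"
      using e d by (simp add: content_cball n_def mult.commute)
    also have "(\<Sum>i<k. norm (e *\<^sub>R y i)) = e * ?L" using e by (simp add: sum_distrib_left)
    finally show ?thesis .
  qed
  \<comment> \<open>\<open>f\<close> vanishes at 0 because \<open>p ^ n\<close> is the volume of the
    unit ball. In the middle term the factor \<open>e * L\<close> is already of first order, so the
    power beside it enters the derivative only through its value 1 at \<open>e = 0\<close>.\<close>
  define f where "f = (\<lambda>e. (1 + e * d) ^ n * ?\<omega> + ?\<omega>' * (1 + e * d + e * ?L) ^ (n - 1) * (e * ?L) - (p + e * q) ^ n)"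
  have pn: "p ^ n = ?\<omega>" using n by (simp add: p_def real_root_pow_pos2)
  have der: "(f has_real_derivative (n * d * ?\<omega> + ?\<omega>' * ?L - n * p ^ (n - 1) * q)) (at 0)"
    unfolding f_def by (auto intro!: derivative_eq_intros)
  have "0 \<le> n * d * ?\<omega> + ?\<omega>' * ?L - n * p ^ (n - 1) * q"
    using der
  proof (rule slope_le_derivative)
    fix e :: real assume "0 < e"
    then show "f 0 + e * 0 \<le> f e" using vol[of e] by (simp add: f_def pn)
  qed
  then show ?thesis by (simp add: p_def q_def)
qed

section \<open>Combining the two estimates\<close>

theorem zonoid_min_projection:
  fixes Z :: "'a::euclidean_space set"
  assumes Z: "zonoid Z" and m: "\<And>\<xi>. norm \<xi> = 1 \<Longrightarrow> m \<le> perp_proj_vol \<xi> Z" "0 \<le> m"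
  defines "n \<equiv> DIM('a)"
  shows "m * root n (unit_ball_vol n) ^ (n - 1) \<le>
    unit_ball_vol (real (n - 1)) * root n (measure lebesgue Z) ^ (n - 1)"
proof -
  let ?V = "measure lebesgue Z" and ?\<omega> = "unit_ball_vol (real n)" and ?\<omega>' = "unit_ball_vol (real (n - 1))"
  have cZ: "compact Z" "convex Z" "interior Z \<noteq> {}" using Z by (auto simp: zonoid_def convex_body_def)
  obtain r where r: "0 < r" "cball 0 r \<subseteq> Z" using zonoid_contains_ball[OF Z] .
  have n: "0 < n" by (simp add: n_def)
  define p where "p = root n ?\<omega>"
  define q where "q = root n ?V"
  have V: "0 < ?V"
    using measure_open_pos[of "interior Z"] cZ measure_mono_fmeasurable[of "interior Z" Z lebesgue]
    by (simp add: interior_subset bounded_interior compact_imp_bounded lmeasurable_compact)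
  have q: "0 < q" "q ^ n = ?V" using V n by (simp_all add: q_def real_root_pow_pos2)
  have bound: "n * p ^ (n - 1) * q * m \<le> n * d * ?\<omega> * m + ?\<omega>' * (n * (1 + d / r) * ?V)" if d: "0 < d" for d :: real
  proof -
    obtain k y w where y: "\<And>a. a \<in> (\<Sum>i<(k::nat). closed_segment 0 (y i)) \<Longrightarrow> \<exists>z\<in>Z. norm (w + a - z) \<le> d"
      "\<And>z. z \<in> Z \<Longrightarrow> \<exists>a\<in>(\<Sum>i<k. closed_segment 0 (y i)). norm (z - (w + a)) \<le> d"
      by (rule zonoid_approx[OF Z d]) blast
    have "n * p ^ (n - 1) * q * m \<le> (n * d * ?\<omega> + ?\<omega>' * (\<Sum>i<k. norm (y i))) * m"
      using segment_length_lower[OF cZ d y(2)] m(2)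
      by (intro mult_right_mono) (simp_all add: p_def q_def n_def)
    also have "\<dots> = n * d * ?\<omega> * m + ?\<omega>' * (m * (\<Sum>i<k. norm (y i)))" by (simp add: algebra_simps)
    also have "\<dots> \<le> n * d * ?\<omega> * m + ?\<omega>' * (n * (1 + d / r) * ?V)"
      using segment_length_upper[OF cZ(1,2) r d m(1) y(1)]
      by (intro add_left_mono mult_left_mono) (simp_all add: n_def)
    finally show ?thesis .
  qed
  \<comment> \<open>The segments and their total length change with \<open>d\<close>, but they have
    been eliminated from \<open>bound\<close>, so \<open>d\<close> may tend to 0.\<close>
  have "n * p ^ (n - 1) * q * m \<le> ?\<omega>' * (n * ?V)"
  proof (rule tendsto_lowerbound)
    show "((\<lambda>d::real. n * d * ?\<omega> * m + ?\<omega>' * (n * (1 + d / r) * ?V)) \<longlongrightarrow> ?\<omega>' * (n * ?V)) (at_right 0)"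
      using r(1) by (auto intro!: tendsto_eq_intros)
    show "\<forall>\<^sub>F d::real in at_right 0. n * p ^ (n - 1) * q * m \<le> n * d * ?\<omega> * m + ?\<omega>' * (n * (1 + d / r) * ?V)"
      using eventually_at_right_less[of 0] by eventually_elim (rule bound)
  qed simp
  \<comment> \<open>Splitting off one factor \<open>q\<close> of the volume exposes the common
    positive factor \<open>n * q\<close>, whose cancellation leaves the exponent
    \<open>n - 1\<close> on both sides.\<close>
  also have "?V = q * q ^ (n - 1)" using q(2) n by (simp add: power_eq_if)
  finally have "(n * q) * (m * p ^ (n - 1)) \<le> (n * q) * (?\<omega>' * q ^ (n - 1))"
    by (simp add: ac_simps)
  then show ?thesis using q n unfolding p_def[symmetric] q_def[symmetric] by simp
qed

theorem lemma3p1: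
  fixes Z :: "(real ^ 'n) set" and n :: nat
  assumes "CARD('n) = n" and "n \<ge> 2" and "zonoid Z"
  shows "\<exists>\<xi>\<in>sphere 0 1.
           (\<forall>\<eta>\<in>sphere 0 1. perp_proj_vol \<xi> Z \<le> perp_proj_vol \<eta> Z) \<and>
           perp_proj_vol \<xi> Z
             \<le> real n * b_const n / (real n - 1) * measure lebesgue Z powr ((real n - 1) / real n)"
proof -
  have DIM: "DIM(real ^ 'n) = n" using assms(1) by simp
  have Z: "compact Z" "convex Z" using assms(3) by (auto simp: zonoid_def convex_body_def)
  obtain r where r: "0 < r" "cball 0 r \<subseteq> Z" using zonoid_contains_ball[OF assms(3)] .
  obtain \<xi> where \<xi>: "norm \<xi> = 1" "\<And>\<eta>. norm \<eta> = 1 \<Longrightarrow> perp_proj_vol \<xi> Z \<le> perp_proj_vol \<eta> Z"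
    by (rule perp_proj_vol_attains_min[OF Z r]) (rule that)
  let ?\<omega> = "unit_ball_vol (real n)" and ?e = "(real n - 1) / real n"
  have root: "root n x ^ (n - 1) = x powr ?e" if "0 \<le> x" for x
    using that assms(2)
    by (simp add: root_powr_inverse powr_realpow' powr_powr of_nat_diff flip: powr_realpow')
  have "perp_proj_vol \<xi> Z * ?\<omega> powr ?e \<le> unit_ball_vol (real n - 1) * measure lebesgue Z powr ?e"
  proof -
    have "0 \<le> perp_proj_vol \<xi> Z" by (simp add: perp_proj_vol_def)
    note zonoid_min_projection[OF assms(3) \<xi>(2) this, unfolded DIM]
    moreover have "real (n - 1) = real n - 1" using assms(2) by simp
    ultimately show ?thesis
      by (simp only: root[OF measure_nonneg] root[OF unit_ball_vol_nonneg[OF of_nat_0_le_iff]])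
  qed
  moreover have "0 < ?\<omega> powr ?e"
    using unit_ball_vol_pos[OF of_nat_0_le_iff[of n]] by (metis less_irrefl powr_gt_zero)
  ultimately have "perp_proj_vol \<xi> Z \<le> unit_ball_vol (real n - 1) / ?\<omega> powr ?e * measure lebesgue Z powr ?e"
    by (simp add: pos_le_divide_eq)
  \<comment> \<open>The factor \<open>n / (n - 1)\<close> undoes the normalisation in
    \<open>b_const\<close>; the cancellation requires \<open>n - 1\<close> to be non-zero.\<close>
  also have "unit_ball_vol (real n - 1) / ?\<omega> powr ?e = real n * b_const n / (real n - 1)"
    using assms(2) by (simp add: b_const_def)
  finally show ?thesis using \<xi> by (intro bexI[of _ \<xi>]) auto
qed

end
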